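(* Assume the integrability condition $\int_{\mathrm{supp}(f)} |f(s)|^{\beta+\frac{c-1}{2}}\,ds<\infty$ holds. Then: (a) For every $v\in L^2(\mathbb{R}^\times,|x|^c dx)$ for which equation (E) has a solution $w\in L^2(\mathbb{R}^\times,|x|^c dx)$, this solution is unique, if and only if $m_{f,+}\neq 0$ and $m_{f,-}\neq 0$ Lebesgue-almost everywhere on $\mathbb{R}$. (b) Equation (E) has a solution $w\in L^2(\mathbb{R}^\times,|x|^c dx)$ for every $v\in L^2(\mathbb{R}^\times,|x|^c dx)$ if and only if $\inf_{x\in\mathbb{R}}|m_{f,+}(x)|>0$ and $\inf_{x\in\mathbb{R}}|m_{f,-}(x)|>0$. (c) Let $\alpha\ge 0$ and $\gamma>0$ be such that $|m_{f,\pm}(x)|\ge \frac{\gamma}{1+|x|^\alpha}$ for all $x\in\mathbb{R}$. If $v\in L^2(\mathbb{R}^\times,|x|^c dx)$ and both functions $x\mapsto (\mathcal{M}v)(e^x)=e^{(c+1)x/2}v(e^x)$ and $x\mapsto(\mathcal{M}v)(-e^x)=e^{(c+1)x/2}v(-e^x)$ belong to $H^\alpha(\mathbb{R})$, then (E) has a unique solution $w\in L^2(\mathbb{R}^\times,|x|^c dx)$.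
   Context: Let $\mathbb{R}^\times=\mathbb{R}\setminus\{0\}$. Let $d\ge 1$, let $f:\mathbb{R}^d\to\mathbb{R}$ be Borel measurable and $\mathrm{supp}(f):=\{s\in\mathbb{R}^d: f(s)\neq 0\}$. Fix $c\ge 0$ and $\beta\in\mathbb{R}$, and let $u:\mathbb{R}^\times\to\mathbb{R}$ be either $u(x)=|x|^\beta$ for all $x$, or $u(x)=\mathrm{sgn}(x)|x|^\beta$ for all $x$. Function spaces are of complex-valued functions (the results are the same for real-valued ones). For given $v\in L^2(\mathbb{R}^\times,|x|^c dx)$, equation (E) for the unknown $w$ is $v(x)=\int_{\mathrm{supp}(f)} \frac{u(f(s))}{|f(s)|}\, w\!\left(\frac{x}{f(s)}\right) ds$ for a.e. $x\in\mathbb{R}^\times$ (this is the relation $uv_1 = $ RHS with $w=uv_0$ between the Lévy density $v_0$ of an infinitely divisible random measure and the Lévy density $v_1$ of the moving average $\int f(t-x)\Lambda(dx)$). Define $m_{f,+}(x)=\int_{\mathrm{supp}(f)} u(f(s))|f(s)|^{(c-1)/2}e^{-ix\log|f(s)|}ds$, $m_{f,-}(x)=\int_{\mathrm{supp}(f)} u(f(s))|f(s)|^{(c-1)/2}e^{-ix\log|f(s)|}\,\mathrm{sgn} f(s)\,ds$ for $x\in\mathbb{R}$. $\mathcal{M}:L^2(\mathbb{R}^\times,|x|^cdx)\to L^2(\mathbb{R}^\times,\frac{dx}{|x|})$ is $(\mathcal{M}u)(x)=|x|^{(c+1)/2}u(x)$. For $\alpha\ge0$, $H^\alpha(\mathbb{R})=\{\varphi\in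 L^2(\mathbb{R}):\int_{\mathbb{R}}|(\mathcal{F}_+\varphi)(\xi)|^2(1+\xi^2)^\alpha d\xi<\infty\}$, where $\mathcal{F}_+$ is the usual Fourier transform on $\mathbb{R}$. *)

theory Defs
  imports "HOL-Analysis.Analysis"
begin

definition u_fun :: "bool \<Rightarrow> real \<Rightarrow> real \<Rightarrow> real" where
  "u_fun sg \<beta> x = (if sg then sgn x else 1) * \<bar>x\<bar> powr \<beta>"

definition rpow :: "real \<Rightarrow> real \<Rightarrow> real" where
  "rpow x a = (if x = 0 then (if a = 0 then 1 else 0) else x powr a)"

text \<open>L2(R^x, abs x ^ c dx), complex valued (the point 0 is a null set).\<close>
definition L2w :: "real \<Rightarrow> (real \<Rightarrow> complex) set" where
  "L2w c = {v. v \<in> borel_measurable lborel \<and>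
                integrable lborel (\<lambda>x. (cmod (v x))\<^sup>2 * \<bar>x\<bar> powr c)}"

definition L2R :: "(real \<Rightarrow> complex) set" where
  "L2R = {v. v \<in> borel_measurable lborel \<and> integrable lborel (\<lambda>x. (cmod (v x))\<^sup>2)}"

definition solves_E :: "('a::euclidean_space \<Rightarrow> real) \<Rightarrow> bool \<Rightarrow> real \<Rightarrow>
    (real \<Rightarrow> complex) \<Rightarrow> (real \<Rightarrow> complex) \<Rightarrow> bool" where
  "solves_E f sg \<beta> v w \<longleftrightarrow> (AE x in lborel. x \<noteq> 0 \<longrightarrow>
      set_integrable lborel {s. f s \<noteq> 0}
        (\<lambda>s. complex_of_real (u_fun sg \<beta> (f s) / \<bar>f s\<bar>) * w (x / f s)) \<and>
      v x = (LINT s:{s. f s \<noteq> 0}|lborel.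
        complex_of_real (u_fun sg \<beta> (f s) / \<bar>f s\<bar>) * w (x / f s)))"

definition m_plus :: "('a::euclidean_space \<Rightarrow> real) \<Rightarrow> bool \<Rightarrow> real \<Rightarrow> real \<Rightarrow> real \<Rightarrow> complex" where
  "m_plus f sg \<beta> c x = (LINT s:{s. f s \<noteq> 0}|lborel.
      complex_of_real (u_fun sg \<beta> (f s) * \<bar>f s\<bar> powr ((c - 1) / 2)) * cis (- x * ln \<bar>f s\<bar>))"

definition m_minus :: "('a::euclidean_space \<Rightarrow> real) \<Rightarrow> bool \<Rightarrow> real \<Rightarrow> real \<Rightarrow> real \<Rightarrow> complex" where
  "m_minus f sg \<beta> c x = (LINT s:{s. f s \<noteq> 0}|lborel.
      complex_of_real (u_fun sg \<beta> (f s) * \<bar>f s\<bar> powr ((c - 1) / 2)) * cis (- x * ln \<bar>f s\<bar>)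
        * complex_of_real (sgn (f s)))"

definition Mop :: "real \<Rightarrow> (real \<Rightarrow> complex) \<Rightarrow> real \<Rightarrow> complex" where
  "Mop c v x = complex_of_real (\<bar>x\<bar> powr ((c + 1) / 2)) * v x"

definition trunc_FT :: "nat \<Rightarrow> (real \<Rightarrow> complex) \<Rightarrow> real \<Rightarrow> complex" where
  "trunc_FT n \<phi> \<xi> = (LINT x:{- real n..real n}|lborel. \<phi> x * cis (- x * \<xi>))"

definition is_L2_FT :: "(real \<Rightarrow> complex) \<Rightarrow> (real \<Rightarrow> complex) \<Rightarrow> bool" where
  "is_L2_FT \<phi> g \<longleftrightarrow> g \<in> L2R \<and>
     (\<lambda>n. \<integral>\<^sup>+ \<xi>. ennreal ((cmod (trunc_FT n \<phi> \<xi> - g \<xi>))\<^sup>2) \<partial>lborel) \<longlonglongrightarrow> 0"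

definition sobolev_H :: "real \<Rightarrow> (real \<Rightarrow> complex) set" where
  "sobolev_H \<alpha> = {\<phi>. \<phi> \<in> L2R \<and> (\<exists>g. is_L2_FT \<phi> g \<and>
      integrable lborel (\<lambda>\<xi>. (cmod (g \<xi>))\<^sup>2 * (1 + \<xi>\<^sup>2) powr \<alpha>))}"

end

theory Submission
  imports Defs "HOL-Probability.Probability"
begin

text \<open>
  In the coordinates \<open>x = \<plusminus> exp t\<close>, and after multiplication by \<open>\<bar>x\<bar> powr ((c + 1) / 2)\<close>,
  the space L2w becomes two copies of L2 of the line, and the integral operator becomes a system of two
  convolutions. Its symmetry under the change of sign decouples it: the sum of the two components is
  convolved with a finite complex measure whose Fourier transform is \<open>m_plus\<close>, their difference with
  one whose Fourier transform is \<open>m_minus\<close>. Convolution with a finite measure is, by Plancherel's theorem,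
  multiplication by its bounded continuous Fourier transform. Such a multiplication operator is
  injective on L2 iff the multiplier vanishes only on a null set, and surjective iff the multiplier is bounded away
  from 0; a Sobolev hypothesis on the right-hand side makes up for a polynomially small multiplier.
\<close>

section \<open>Square-integrable functions on the line\<close>

text \<open>The exponent of the weight is forced: with x = e^t the measure |x|^c dx becomes
  e^((c+1)t) dt, so a factor |x|^((c+1)/2) leads to plain L2 of dt. Dividing x by f(s) shifts t by
  ln |f(s)|, and moving the weight across the shift turns u(f)/|f| into u(f) |f|^((c-1)/2); the
  integrability hypothesis says exactly that this kernel is in L1. A negative f(s) also exchanges
  the two half-lines, which fixes the sum of the two components and negates their difference, whence
  the factor sgn f(s) in \<open>m_minus\<close>. The L2 transform is a relation
  \<open>is_L2_FT\<close>, determined up to null sets by limits along truncations, so facts about it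
  are proved for integrable functions and passed to the limit in squared norm. Two of them carry the
  argument: every L2 function is a transform, so test data can be chosen on the frequency side; and
  a function vanishes a.e. iff its transform does, so equations can be compared there. Necessity in
  (b) rests on an explicit right-hand side without solution instead of the open mapping
  theorem.\<close>

definition nsq :: "(real \<Rightarrow> complex) \<Rightarrow> ennreal" where
  "nsq \<phi> = (\<integral>\<^sup>+ x. ennreal ((cmod (\<phi> x))\<^sup>2) \<partial>lborel)"

lemma L2R_iff: "\<phi> \<in> L2R \<longleftrightarrow> \<phi> \<in> borel_measurable borel \<and> nsq \<phi> < \<infinity>"
  unfolding L2R_def nsq_def by (auto simp: integrable_iff_bounded)

lemma cmod_add_sq_le: "(cmod (a + b))\<^sup>2 \<le> 2 * (cmod a)\<^sup>2 + 2 * (cmod b)\<^sup>2"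
proof -
  have "(cmod (a + b))\<^sup>2 \<le> (cmod a + cmod b)\<^sup>2"
    by (simp add: norm_triangle_ineq power_mono)
  also have "\<dots> \<le> 2 * (cmod a)\<^sup>2 + 2 * (cmod b)\<^sup>2"
    using sum_squares_bound[of "cmod a" "cmod b"] by (simp add: power2_sum)
  finally show ?thesis .
qed

text \<open>Stands in for the triangle inequality: the factors 2 spare square roots in
  \<open>ennreal\<close> and are harmless, since \<open>nsq\<close> is only used to show finiteness
  or convergence to 0.\<close>

lemma nsq_add_le:
  assumes [measurable]: "\<phi> \<in> borel_measurable borel" "\<psi> \<in> borel_measurable borel"
  shows "nsq (\<lambda>x. \<phi> x + \<psi> x) \<le> 2 * nsq \<phi> + 2 * nsq \<psi>"
proof -
  have "nsq (\<lambda>x. \<phi> x + \<psi> x) \<le> (\<integral>\<^sup>+ x. 2 * ennreal ((cmod (\<phi> x))\<^sup>2) + 2 * ennreal ((cmod (\<psi> x))\<^sup>2) \<partial>lborel)"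
    unfolding nsq_def
  proof (rule nn_integral_mono)
    fix x
    have "ennreal ((cmod (\<phi> x + \<psi> x))\<^sup>2) \<le> ennreal (2 * (cmod (\<phi> x))\<^sup>2 + 2 * (cmod (\<psi> x))\<^sup>2)"
      by (intro ennreal_leI cmod_add_sq_le)
    then show "ennreal ((cmod (\<phi> x + \<psi> x))\<^sup>2) \<le> 2 * ennreal ((cmod (\<phi> x))\<^sup>2) + 2 * ennreal ((cmod (\<psi> x))\<^sup>2)"
      by (simp add: ennreal_plus ennreal_mult)
  qed
  also have "\<dots> = 2 * nsq \<phi> + 2 * nsq \<psi>"
    unfolding nsq_def by (subst nn_integral_add) (auto simp: nn_integral_cmult)
  finally show ?thesis .
qed

lemma nsq_cmult:
  assumes [measurable]: "\<phi> \<in> borel_measurable borel"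
  shows "nsq (\<lambda>x. a * \<phi> x) = ennreal ((cmod a)\<^sup>2) * nsq \<phi>"
  unfolding nsq_def by (simp add: norm_mult power_mult_distrib ennreal_mult nn_integral_cmult)

lemma nsq_minus: "nsq (\<lambda>x. - \<phi> x) = nsq \<phi>"
  by (simp add: nsq_def)

lemma nsq_diff_commute: "nsq (\<lambda>x. \<phi> x - \<psi> x) = nsq (\<lambda>x. \<psi> x - \<phi> x)"
  by (simp add: nsq_def norm_minus_commute)

lemma nsq_diff_le:
  assumes [measurable]: "\<phi> \<in> borel_measurable borel" "\<psi> \<in> borel_measurable borel"
  shows "nsq (\<lambda>x. \<phi> x - \<psi> x) \<le> 2 * nsq \<phi> + 2 * nsq \<psi>"
  using nsq_add_le[of \<phi> "\<lambda>x. - \<psi> x"] by (simp add: nsq_minus)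

lemma nsq_diff_triangle:
  assumes [measurable]: "\<phi> \<in> borel_measurable borel" "\<psi> \<in> borel_measurable borel" "\<eta> \<in> borel_measurable borel"
  shows "nsq (\<lambda>x. \<phi> x - \<eta> x) \<le> 2 * nsq (\<lambda>x. \<phi> x - \<psi> x) + 2 * nsq (\<lambda>x. \<psi> x - \<eta> x)"
  using nsq_add_le[of "\<lambda>x. \<phi> x - \<psi> x" "\<lambda>x. \<psi> x - \<eta> x"] by simp

lemma nsq_mono:
  assumes "\<And>x. cmod (\<phi> x) \<le> cmod (\<psi> x)"
  shows "nsq \<phi> \<le> nsq \<psi>"
  unfolding nsq_def by (intro nn_integral_mono ennreal_leI power_mono assms) auto

lemma nsq_cong_AE: "AE x in lborel. \<phi> x = \<psi> x \<Longrightarrow> nsq \<phi> = nsq \<psi>"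
  unfolding nsq_def by (intro nn_integral_cong_AE) auto

lemma nsq_eq_0_iff:
  assumes [measurable]: "\<phi> \<in> borel_measurable borel"
  shows "nsq \<phi> = 0 \<longleftrightarrow> (AE x in lborel. \<phi> x = 0)"
  unfolding nsq_def by (subst nn_integral_0_iff_AE) auto

lemma L2R_add: "\<phi> \<in> L2R \<Longrightarrow> \<psi> \<in> L2R \<Longrightarrow> (\<lambda>x. \<phi> x + \<psi> x) \<in> L2R"
  using nsq_add_le[of \<phi> \<psi>] by (auto simp: L2R_iff ennreal_mult_less_top intro: le_less_trans)

lemma L2R_cmult: "\<phi> \<in> L2R \<Longrightarrow> (\<lambda>x. a * \<phi> x) \<in> L2R"
  by (auto simp: L2R_iff nsq_cmult ennreal_mult_less_top)

lemma L2R_diff: "\<phi> \<in> L2R \<Longrightarrow> \<psi> \<in> L2R \<Longrightarrow> (\<lambda>x. \<phi> x - \<psi> x) \<in> L2R"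
  using nsq_diff_le[of \<phi> \<psi>] by (auto simp: L2R_iff ennreal_mult_less_top intro: le_less_trans)

lemma L2R_zero: "(\<lambda>x. 0) \<in> L2R"
  by (simp add: L2R_iff nsq_def)

lemma nsq_affine:
  assumes [measurable]: "\<phi> \<in> borel_measurable borel" and "\<bar>c\<bar> = 1"
  shows "nsq (\<lambda>x. \<phi> (t + c * x)) = nsq \<phi>"
proof -
  have "c \<noteq> 0" using assms by auto
  then show ?thesis
  unfolding nsq_def using nn_integral_real_affine[of "\<lambda>x. ennreal ((cmod (\<phi> x))\<^sup>2)" c t] assms by simp
qed

text \<open>Shaped to match \<open>nsq_diff_triangle\<close>: together they pass from two L2
  approximations to a third.\<close>

lemma tendsto_zero_sandwich_double:
  fixes a b c :: "nat \<Rightarrow> ennreal"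
  assumes "b \<longlonglongrightarrow> 0" "c \<longlonglongrightarrow> 0" "\<And>n. a n \<le> 2 * b n + 2 * c n"
  shows "a \<longlonglongrightarrow> 0"
proof (rule tendsto_sandwich[where f="\<lambda>_. 0" and h="\<lambda>n. 2 * b n + 2 * c n"])
  have "(\<lambda>n. 2 * b n + 2 * c n) \<longlonglongrightarrow> 2 * 0 + 2 * 0"
    by (intro tendsto_add ennreal_tendsto_cmult assms) auto
  then show "(\<lambda>n. 2 * b n + 2 * c n) \<longlonglongrightarrow> 0" by simp
qed (use assms in auto)

lemma nsq_dominated_convergence:
  assumes [measurable]: "\<And>n. \<phi> n \<in> borel_measurable borel"
    and d: "d \<in> L2R" "\<And>n. AE x in lborel. cmod (\<phi> n x) \<le> cmod (d x)"
    and lim: "AE x in lborel. (\<lambda>n. \<phi> n x) \<longlonglongrightarrow> 0"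
  shows "(\<lambda>n. nsq (\<phi> n)) \<longlonglongrightarrow> 0"
proof -
  have [measurable]: "d \<in> borel_measurable borel" using d L2R_iff by auto
  have "(\<lambda>n. \<integral>\<^sup>+ x. ennreal ((cmod (\<phi> n x))\<^sup>2) \<partial>lborel) \<longlonglongrightarrow> (\<integral>\<^sup>+ x. 0 \<partial>(lborel :: real measure))"
  proof (rule nn_integral_dominated_convergence[where w="\<lambda>x. ennreal ((cmod (d x))\<^sup>2)"])
    show "AE x in lborel. ennreal ((cmod (\<phi> j x))\<^sup>2) \<le> ennreal ((cmod (d x))\<^sup>2)" for j
      using d(2)[of j] by eventually_elim (intro ennreal_leI power_mono, auto)
    show "(\<integral>\<^sup>+ x. ennreal ((cmod (d x))\<^sup>2) \<partial>lborel) < \<infinity>"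
      using d(1) by (simp add: L2R_iff nsq_def)
    show "AE x in lborel. (\<lambda>n. ennreal ((cmod (\<phi> n x))\<^sup>2)) \<longlonglongrightarrow> 0"
      using lim
    proof eventually_elim
      case (elim x)
      have "(\<lambda>n. (cmod (\<phi> n x))\<^sup>2) \<longlonglongrightarrow> (cmod 0)\<^sup>2"
        by (intro tendsto_intros elim)
      then show ?case using tendsto_ennrealI by fastforce
    qed
  qed auto
  then show ?thesis by (simp add: nsq_def)
qed

text \<open>Riesz-Fischer: a fast subsequence converges almost everywhere because its increments are
  eventually dominated by a geometric sequence, and Fatou's lemma carries the Cauchy estimate over
  to the pointwise limit.\<close>

lemma L2_complete:
  assumes h: "\<And>n. h n \<in> L2R"
    and cauchy: "\<And>e::real. e > 0 \<Longrightarrow> \<exists>N. \<forall>m\<ge>N. \<forall>n\<ge>N. nsq (\<lambda>x. h m x - h n x) \<le> ennreal e"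
  shows "\<exists>g \<in> L2R. (\<lambda>n. nsq (\<lambda>x. h n x - g x)) \<longlonglongrightarrow> 0"
proof -
  have [measurable]: "h n \<in> borel_measurable borel" for n using h L2R_iff by auto
  \<comment> \<open>The rate 8^(-k) leaves room for a weight 2^k: the weighted squared increments
    still have integrals summing like 4^(-k), and their a.e. convergence to 0 bounds the k-th
    increment by 2^(-k/2).\<close>
  have "\<exists>N. \<forall>m\<ge>N. \<forall>n\<ge>N. nsq (\<lambda>x. h m x - h n x) \<le> ennreal ((1/8)^k)" for k :: nat
    by (rule cauchy) simp
  then obtain N where N: "\<And>k m n. m \<ge> N k \<Longrightarrow> n \<ge> N k \<Longrightarrow> nsq (\<lambda>x. h m x - h n x) \<le> ennreal ((1/8)^k)"
    by metis
  define r where "r = rec_nat (N 0) (\<lambda>k p. max (Suc p) (N (Suc k)))"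
  have r_Suc: "r (Suc k) = max (Suc (r k)) (N (Suc k))" for k by (simp add: r_def)
  have rN: "r k \<ge> N k" for k by (cases k) (auto simp: r_Suc, simp add: r_def)
  have smono: "strict_mono r" by (intro strict_mono_Suc_iff[THEN iffD2] allI) (simp add: r_Suc less_max_iff_disj)
  define \<Delta> where "\<Delta> k x = h (r (Suc k)) x - h (r k) x" for k x
  have [measurable]: "\<Delta> k \<in> borel_measurable borel" for k unfolding \<Delta>_def by measurable
  have \<Delta>: "nsq (\<Delta> k) \<le> ennreal ((1/8)^k)" for k
    unfolding \<Delta>_def using rN[of k] strict_mono_leD[OF smono, of k "Suc k"] by (intro N) auto
  have "(\<integral>\<^sup>+x. (\<Sum>k. ennreal (2^k * (cmod (\<Delta> k x))\<^sup>2)) \<partial>lborel) = (\<Sum>k. ennreal (2^k) * nsq (\<Delta> k))"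
    by (subst nn_integral_suminf) (auto simp: nsq_def ennreal_mult nn_integral_cmult)
  also have "\<dots> \<le> (\<Sum>k. ennreal ((1/4)^k))"
  proof (rule suminf_le)
    fix k
    have "ennreal (2^k) * nsq (\<Delta> k) \<le> ennreal (2^k) * ennreal ((1/8)^k)"
      by (intro mult_left_mono \<Delta>) auto
    also have "\<dots> = ennreal (2^k * (1/8)^k)" by (simp add: ennreal_mult)
    also have "2^k * (1/8::real)^k = (1/4)^k" by (simp flip: power_mult_distrib)
    finally show "ennreal (2^k) * nsq (\<Delta> k) \<le> ennreal ((1/4)^k)" .
  qed auto
  also have "\<dots> = ennreal (\<Sum>k. (1/4)^k)"
    by (rule suminf_ennreal2) (auto intro: summable_geometric)
  also have "\<dots> < \<infinity>" by simp
  finally have "AE x in lborel. (\<Sum>k. ennreal (2^k * (cmod (\<Delta> k x))\<^sup>2)) \<noteq> \<infinity>"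
    by (intro nn_integral_PInf_AE) auto
  then have conv: "AE x in lborel. convergent (\<lambda>k. h (r k) x)"
  proof eventually_elim
    case (elim x)
    have "summable (\<lambda>k. 2^k * (cmod (\<Delta> k x))\<^sup>2)"
      using elim by (intro summable_suminf_not_top) (auto simp: top_ennreal_def)
    then have "(\<lambda>k. 2^k * (cmod (\<Delta> k x))\<^sup>2) \<longlonglongrightarrow> 0" by (rule summable_LIMSEQ_zero)
    then have "eventually (\<lambda>k. 2^k * (cmod (\<Delta> k x))\<^sup>2 < 1) sequentially"
      by (rule order_tendstoD) simp
    then have ev: "eventually (\<lambda>k. norm (\<Delta> k x) \<le> (sqrt (1/2))^k) sequentially"
    proof eventually_elim
      case (elim k)
      have "(cmod (\<Delta> k x))\<^sup>2 \<le> (1/2)^k" using elim by (simp add: field_simps)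
      then have "cmod (\<Delta> k x) \<le> sqrt ((1/2)^k)" using real_le_rsqrt by blast
      then show ?case by (simp add: real_sqrt_power)
    qed
    have "sqrt (1/2) < (1::real)" using real_sqrt_less_mono[of "1/2" 1] by simp
    then have "summable (\<lambda>k. (sqrt (1/2))^k)" by (intro summable_geometric) auto
    then have "summable (\<lambda>k. \<Delta> k x)" using ev by (rule summable_comparison_test_ev[rotated])
    then have "convergent (\<lambda>n. \<Sum>k<n. \<Delta> k x)" by (simp add: summable_iff_convergent)
    moreover have "(\<Sum>k<n. \<Delta> k x) = h (r n) x - h (r 0) x" for n
      unfolding \<Delta>_def by (rule sum_lessThan_telescope)
    ultimately have "convergent (\<lambda>n. (h (r n) x - h (r 0) x) + h (r 0) x)"
      by (intro convergent_add) (auto simp: convergent_const)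
    then show ?case by simp
  qed
  define g where "g x = lim (\<lambda>k. h (r k) x)" for x
  have [measurable]: "g \<in> borel_measurable borel" unfolding g_def by measurable
  have lim: "AE x in lborel. (\<lambda>k. h (r k) x) \<longlonglongrightarrow> g x"
    using conv by eventually_elim (simp add: g_def convergent_LIMSEQ_iff)
  \<comment> \<open>Fatou along the subsequence, with n fixed.\<close>
  have bound: "nsq (\<lambda>x. h n x - g x) \<le> ennreal e"
    if "\<forall>m\<ge>K. \<forall>n\<ge>K. nsq (\<lambda>x. h m x - h n x) \<le> ennreal e" "n \<ge> K" for n K e
  proof -
    have "nsq (\<lambda>x. h n x - g x) = (\<integral>\<^sup>+x. liminf (\<lambda>k. ennreal ((cmod (h n x - h (r k) x))\<^sup>2)) \<partial>lborel)"
      unfolding nsq_def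
    proof (rule nn_integral_cong_AE, use lim in eventually_elim)
      case (elim x)
      have "(\<lambda>k. ennreal ((cmod (h n x - h (r k) x))\<^sup>2)) \<longlonglongrightarrow> ennreal ((cmod (h n x - g x))\<^sup>2)"
        by (intro tendsto_ennrealI tendsto_intros elim)
      then show ?case by (subst lim_imp_Liminf) auto
    qed
    also have "\<dots> \<le> liminf (\<lambda>k. nsq (\<lambda>x. h n x - h (r k) x))"
      unfolding nsq_def by (rule nn_integral_liminf) auto
    also have "\<dots> \<le> ennreal e"
    proof (rule Liminf_le)
      show "\<forall>\<^sub>F k in sequentially. nsq (\<lambda>x. h n x - h (r k) x) \<le> ennreal e"
        using eventually_ge_at_top[of K]
      proof eventually_elim
        case (elim k)
        then have "r k \<ge> K" using strict_mono_imp_increasing[OF smono, of k] by linarith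
        then show ?case using that by blast
      qed
    qed auto
    finally show ?thesis .
  qed
  have tend: "(\<lambda>n. nsq (\<lambda>x. h n x - g x)) \<longlonglongrightarrow> 0"
  proof (rule tendsto_0_if_Limsup_eq_0_ennreal, rule antisym)
    show "limsup (\<lambda>n. nsq (\<lambda>x. h n x - g x)) \<le> 0"
    proof (rule ennreal_le_epsilon)
      fix e :: real assume "e > 0"
      from cauchy[OF this] obtain K where K: "\<forall>m\<ge>K. \<forall>n\<ge>K. nsq (\<lambda>x. h m x - h n x) \<le> ennreal e" by auto
      have "\<forall>\<^sub>F n in sequentially. nsq (\<lambda>x. h n x - g x) \<le> ennreal e"
        using eventually_ge_at_top[of K] by eventually_elim (rule bound[OF K])
      then show "limsup (\<lambda>n. nsq (\<lambda>x. h n x - g x)) \<le> 0 + ennreal e"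
        by (simp add: Limsup_bounded)
    qed
  qed auto
  from cauchy[of 1] obtain K where K: "\<forall>m\<ge>K. \<forall>n\<ge>K. nsq (\<lambda>x. h m x - h n x) \<le> ennreal 1" by auto
  have "nsq (\<lambda>x. h K x - g x) < \<infinity>" using bound[OF K, of K] by (auto intro: le_less_trans)
  then have "(\<lambda>x. h K x - g x) \<in> L2R" by (simp add: L2R_iff)
  from L2R_diff[OF h[of K] this] have "g \<in> L2R" by simp
  with tend show ?thesis by auto
qed


section \<open>Truncation, density of continuous functions, continuity of translation\<close>

lemma ennreal_double_add:
  "0 \<le> a \<Longrightarrow> 0 \<le> b \<Longrightarrow> 2 * ennreal a + 2 * ennreal b = ennreal (2 * a + 2 * b)"
  by (simp add: ennreal_mult)

text \<open>Turns truncation into an operation on functions, so that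
  \<open>trunc_FT n \<phi>\<close> is the ordinary transform of \<open>cut n \<phi>\<close>, which
  lies in both L1 and L2 when \<phi> is in L2.\<close>

definition cut :: "nat \<Rightarrow> (real \<Rightarrow> complex) \<Rightarrow> real \<Rightarrow> complex" where
  "cut n \<phi> x = indicator {- real n..real n} x *\<^sub>R \<phi> x"

lemma measurable_cut [measurable]: "\<phi> \<in> borel_measurable borel \<Longrightarrow> cut n \<phi> \<in> borel_measurable borel"
  unfolding cut_def by measurable

lemma cmod_cut_le: "cmod (cut n \<phi> x) \<le> cmod (\<phi> x)"
  by (auto simp: cut_def indicator_def)

lemma L2R_bounded_support:
  assumes [measurable]: "\<phi> \<in> borel_measurable borel"
    and b: "\<And>x. cmod (\<phi> x) \<le> C * indicator {-R..R} x"
  shows "\<phi> \<in> L2R"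
proof -
  have "nsq \<phi> \<le> (\<integral>\<^sup>+x. ennreal (C\<^sup>2) * indicator {-R..R} x \<partial>lborel)"
    unfolding nsq_def
  proof (rule nn_integral_mono)
    fix x
    have "(cmod (\<phi> x))\<^sup>2 \<le> (C * indicator {-R..R} x)\<^sup>2" by (intro power_mono b) auto
    then show "ennreal ((cmod (\<phi> x))\<^sup>2) \<le> ennreal (C\<^sup>2) * indicator {-R..R} x"
      by (auto simp: indicator_def ennreal_leI)
  qed
  also have "\<dots> < \<infinity>" by (simp add: nn_integral_cmult_indicator ennreal_mult_less_top emeasure_lborel_Icc_eq)
  finally show ?thesis by (simp add: L2R_iff)
qed

lemma L2R_cut: "\<phi> \<in> L2R \<Longrightarrow> cut n \<phi> \<in> L2R"
  using nsq_mono[of "cut n \<phi>" \<phi>] by (auto simp: L2R_iff cmod_cut_le intro: le_less_trans)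

lemma cut_tendsto:
  assumes "\<phi> \<in> L2R"
  shows "(\<lambda>n. nsq (\<lambda>x. cut n \<phi> x - \<phi> x)) \<longlonglongrightarrow> 0"
proof (rule nsq_dominated_convergence[where d=\<phi>])
  have [measurable]: "\<phi> \<in> borel_measurable borel" using assms L2R_iff by auto
  show "(\<lambda>x. cut n \<phi> x - \<phi> x) \<in> borel_measurable borel" for n by measurable
  show "AE x in lborel. cmod (cut n \<phi> x - \<phi> x) \<le> cmod (\<phi> x)" for n
    by (auto simp: cut_def indicator_def)
  show "AE x in lborel. (\<lambda>n. cut n \<phi> x - \<phi> x) \<longlonglongrightarrow> 0"
  proof (rule AE_I2, rule tendsto_eventually)
    fix x :: real
    obtain N where N: "real N \<ge> \<bar>x\<bar>" using real_arch_simple by blast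
    show "\<forall>\<^sub>F n in sequentially. cut n \<phi> x - \<phi> x = 0"
      using eventually_ge_at_top[of N]
    proof eventually_elim
      case (elim n)
      then have "real n \<ge> \<bar>x\<bar>" using N by linarith
      then show ?case by (auto simp: cut_def indicator_def)
    qed
  qed
qed (rule assms)

text \<open>A truncation of \<phi> in both domain and size is an a.e. limit of continuous functions.
  These need not be bounded or compactly supported, so they are clipped before dominated convergence
  is applied.\<close>

lemma continuous_dense_L2:
  assumes \<phi>: "\<phi> \<in> L2R" and e: "e > 0"
  shows "\<exists>h C R. continuous_on UNIV h \<and> (\<forall>x. cmod (h x) \<le> C * indicator {-R..R} x)
    \<and> nsq (\<lambda>x. \<phi> x - h x) \<le> ennreal e"
proof -
  have [measurable]: "\<phi> \<in> borel_measurable borel" using \<phi> L2R_iff by auto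
  define \<psi> where "\<psi> k x = (if \<bar>x\<bar> \<le> real k \<and> cmod (\<phi> x) \<le> real k then \<phi> x else 0)" for k x
  have [measurable]: "\<psi> k \<in> borel_measurable borel" for k unfolding \<psi>_def by measurable
  have "(\<lambda>k. nsq (\<lambda>x. \<phi> x - \<psi> k x)) \<longlonglongrightarrow> 0"
  proof (rule nsq_dominated_convergence[OF _ \<phi>])
    show "AE x in lborel. (\<lambda>k. \<phi> x - \<psi> k x) \<longlonglongrightarrow> 0"
    proof (rule AE_I2, rule tendsto_eventually)
      fix x :: real
      obtain N where N: "real N \<ge> max \<bar>x\<bar> (cmod (\<phi> x))" using real_arch_simple by blast
      show "\<forall>\<^sub>F k in sequentially. \<phi> x - \<psi> k x = 0"
        using eventually_ge_at_top[of N]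
      proof eventually_elim
        case (elim k)
        then have "real k \<ge> max \<bar>x\<bar> (cmod (\<phi> x))" using N by linarith
        then show ?case by (auto simp: \<psi>_def)
      qed
    qed
  qed (auto simp: \<psi>_def)
  then have "eventually (\<lambda>k. nsq (\<lambda>x. \<phi> x - \<psi> k x) < ennreal (e/4)) sequentially"
    using e by (intro order_tendstoD) auto
  then have "eventually (\<lambda>k. nsq (\<lambda>x. \<phi> x - \<psi> k x) < ennreal (e/4) \<and> k \<ge> 1) sequentially"
    by (intro eventually_conj eventually_ge_at_top)
  then obtain k where k: "nsq (\<lambda>x. \<phi> x - \<psi> k x) < ennreal (e/4)" "k \<ge> 1"
    using eventually_happens'[OF sequentially_bot] by blast
  define K where "K = real k"
  have K: "K > 0" using k by (simp add: K_def)
  have "\<psi> k \<in> borel_measurable lebesgue" by (intro measurable_completion) simp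
  then have "\<psi> k measurable_on UNIV"
    by (intro lebesgue_measurable_imp_measurable_on) (auto simp: lebesgue_on_UNIV_eq)
  then obtain N g where N: "negligible N" and g: "\<And>n. continuous_on UNIV (g n)"
    and lim: "\<And>x. x \<notin> N \<Longrightarrow> (\<lambda>n. g n x) \<longlonglongrightarrow> \<psi> k x"
    unfolding measurable_on_def by auto
  have [measurable]: "g n \<in> borel_measurable borel" for n
    by (rule borel_measurable_continuous_onI[OF g])
  \<comment> \<open>\<open>p\<close> is the radial retraction onto the disc of radius
    \<open>K\<close>, and \<open>c\<close> a ramp that is 1 on [-K, K] and 0 outside [-(K+1), K+1].
    Both leave the limit \<open>\<psi> k\<close> unchanged, since it is bounded by \<open>K\<close>
    and supported in [-K, K]; \<open>k \<ge> 1\<close> keeps the denominator positive.\<close>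
  define p where "p z = complex_of_real (K / max K (cmod z)) * z" for z
  define c where "c x = max 0 (min 1 (K + 1 - \<bar>x\<bar>))" for x :: real
  define h where "h n x = complex_of_real (c x) * p (g n x)" for n x
  have p: "continuous_on UNIV p"
    unfolding p_def using K by (intro continuous_intros) auto
  have pb: "cmod (p z) \<le> K" for z
  proof -
    have "cmod (p z) = K / max K (cmod z) * cmod z"
      using K by (simp add: p_def norm_mult norm_divide del: of_real_divide)
    also have "\<dots> \<le> K" using K by (auto simp: max_def field_simps)
    finally show ?thesis .
  qed
  have pid: "p z = z" if "cmod z \<le> K" for z
    using K that by (auto simp: p_def max_def)
  have cc: "continuous_on UNIV c" unfolding c_def by (intro continuous_intros)
  have cb: "0 \<le> c x" "c x \<le> indicator {-(K+1)..K+1} x" for x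
    by (auto simp: c_def indicator_def)
  have hc: "continuous_on UNIV (h n)" for n
    unfolding h_def by (intro continuous_intros cc continuous_on_compose2[OF p g]) auto
  have [measurable]: "h n \<in> borel_measurable borel" for n
    by (rule borel_measurable_continuous_onI[OF hc])
  have hb: "cmod (h n x) \<le> K * indicator {-(K+1)..K+1} x" for n x
  proof -
    have "c x * cmod (p (g n x)) \<le> indicator {-(K+1)..K+1} x * K"
      using cb[of x] pb[of "g n x"] K by (intro mult_mono) auto
    then show ?thesis using cb[of x] by (simp add: h_def norm_mult mult_ac)
  qed
  have \<psi>b: "cmod (\<psi> k x) \<le> K * indicator {-(K+1)..K+1} x" for x
    by (auto simp: \<psi>_def K_def indicator_def)
  have "(\<lambda>n. nsq (\<lambda>x. \<psi> k x - h n x)) \<longlonglongrightarrow> 0"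
  proof (rule nsq_dominated_convergence)
    show "(\<lambda>x. complex_of_real (2 * K * indicator {-(K+1)..K+1} x)) \<in> L2R"
      using K by (intro L2R_bounded_support[of _ "2*K" "K+1"]) (auto simp: indicator_def)
    show "AE x in lborel. cmod (\<psi> k x - h n x) \<le> cmod (complex_of_real (2 * K * indicator {-(K+1)..K+1} x))" for n
    proof (rule AE_I2)
      fix x
      show "cmod (\<psi> k x - h n x) \<le> cmod (complex_of_real (2 * K * indicator {-(K+1)..K+1} x))"
        using norm_triangle_ineq4[of "\<psi> k x" "h n x"] hb[of n x] \<psi>b[of x] K
        by (auto simp: indicator_def split: if_splits)
    qed
    have "AE x in lebesgue. x \<notin> N"
      using N by (simp add: negligible_iff_null_sets AE_not_in)
    then have "AE x in lborel. x \<notin> N" by (simp add: AE_completion_iff)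
    then show "AE x in lborel. (\<lambda>n. \<psi> k x - h n x) \<longlonglongrightarrow> 0"
    proof eventually_elim
      case (elim x)
      have "isCont p (\<psi> k x)" using p by (simp add: continuous_on_eq_continuous_at)
      then have "(\<lambda>n. p (g n x)) \<longlonglongrightarrow> p (\<psi> k x)"
        using lim[OF elim] by (rule isCont_tendsto_compose)
      then have "(\<lambda>n. \<psi> k x - complex_of_real (c x) * p (g n x)) \<longlonglongrightarrow> \<psi> k x - complex_of_real (c x) * p (\<psi> k x)"
        by (intro tendsto_intros)
      moreover have "p (\<psi> k x) = \<psi> k x" by (rule pid) (auto simp: \<psi>_def K_def)
      moreover have "complex_of_real (c x) * \<psi> k x = \<psi> k x" by (auto simp: \<psi>_def c_def K_def)
      ultimately show ?case by (simp add: h_def)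
    qed
  qed measurable
  then have "eventually (\<lambda>n. nsq (\<lambda>x. \<psi> k x - h n x) < ennreal (e/4)) sequentially"
    using e by (intro order_tendstoD) auto
  then obtain n where n: "nsq (\<lambda>x. \<psi> k x - h n x) < ennreal (e/4)"
    using eventually_happens'[OF sequentially_bot] by blast
  have "nsq (\<lambda>x. \<phi> x - h n x) \<le> 2 * nsq (\<lambda>x. \<phi> x - \<psi> k x) + 2 * nsq (\<lambda>x. \<psi> k x - h n x)"
    by (rule nsq_diff_triangle) measurable
  also have "\<dots> \<le> 2 * ennreal (e/4) + 2 * ennreal (e/4)"
    using k n by (intro add_mono mult_left_mono) auto
  also have "\<dots> = ennreal (2 * (e/4) + 2 * (e/4))" using e by (simp add: ennreal_double_add del: ennreal_plus)
  finally show ?thesis using hc hb by (intro exI[of _ "h n"] exI[of _ K] exI[of _ "K+1"]) (auto simp: field_simps)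
qed

text \<open>For a continuous function of compact support this is dominated convergence; the general
  case follows by density, because translations preserve \<open>nsq\<close>.\<close>

lemma translation_continuous_L2:
  assumes \<phi>: "\<phi> \<in> L2R" and t: "t \<longlonglongrightarrow> 0"
  shows "(\<lambda>n::nat. nsq (\<lambda>x. \<phi> (t n + x) - \<phi> x)) \<longlonglongrightarrow> 0"
proof (rule tendsto_0_if_Limsup_eq_0_ennreal, rule antisym)
  have [measurable]: "\<phi> \<in> borel_measurable borel" using \<phi> L2R_iff by auto
  show "limsup (\<lambda>n. nsq (\<lambda>x. \<phi> (t n + x) - \<phi> x)) \<le> 0"
  proof (rule ennreal_le_epsilon)
    fix e :: real assume e: "e > 0"
    \<comment> \<open>Two uses of the doubled triangle inequality weight the three errors by 2, 4
      and 4, hence the tenth.\<close>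
    obtain h C R where h: "continuous_on UNIV h" "\<And>x. cmod (h x) \<le> C * indicator {-R..R} x"
      and a: "nsq (\<lambda>x. \<phi> x - h x) \<le> ennreal (e/10)"
      using continuous_dense_L2[OF \<phi>, of "e/10"] e by auto
    have [measurable]: "h \<in> borel_measurable borel" by (rule borel_measurable_continuous_onI[OF h(1)])
    \<comment> \<open>Setting the difference to 0 for shifts larger than 1 lets one dominating
      function, supported in [-(R+1), R+1], serve every n; since t n tends to 0, this changes only
      finitely many terms.\<close>
    have "(\<lambda>n. nsq (\<lambda>x. if \<bar>t n\<bar> \<le> 1 then h (t n + x) - h x else 0)) \<longlonglongrightarrow> 0"
    proof (rule nsq_dominated_convergence)
      show "(\<lambda>x. complex_of_real (2 * \<bar>C\<bar> * indicator {-(R+1)..R+1} x)) \<in> L2R"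
        by (intro L2R_bounded_support[of _ "2*\<bar>C\<bar>" "R+1"]) (auto simp: indicator_def)
      show "AE x in lborel. cmod (if \<bar>t n\<bar> \<le> 1 then h (t n + x) - h x else 0) \<le>
          cmod (complex_of_real (2 * \<bar>C\<bar> * indicator {-(R+1)..R+1} x))" for n
      proof (rule AE_I2)
        fix x
        have b: "cmod (h y) \<le> \<bar>C\<bar> * indicator {-(R+1)..R+1} x" if "\<bar>y - x\<bar> \<le> 1" for y
        proof -
          have "indicator {-R..R} y \<le> (indicator {-(R+1)..R+1} x :: real)"
            using that by (auto simp: indicator_def)
          then have "C * indicator {-R..R} y \<le> \<bar>C\<bar> * indicator {-(R+1)..R+1} x"
            by (intro mult_mono) auto
          then show ?thesis using h(2)[of y] by linarith
        qed
        show "cmod (if \<bar>t n\<bar> \<le> 1 then h (t n + x) - h x else 0) \<le>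
          cmod (complex_of_real (2 * \<bar>C\<bar> * indicator {-(R+1)..R+1} x))"
          using norm_triangle_ineq4[of "h (t n + x)" "h x"] b[of "t n + x"] b[of x]
          by (auto simp: norm_mult)
      qed
      show "AE x in lborel. (\<lambda>n. if \<bar>t n\<bar> \<le> 1 then h (t n + x) - h x else 0) \<longlonglongrightarrow> 0"
      proof (rule AE_I2)
        fix x
        have "isCont h (0 + x)" using h(1) by (simp add: continuous_on_eq_continuous_at)
        then have "(\<lambda>n. h (t n + x)) \<longlonglongrightarrow> h (0 + x)"
          by (rule isCont_tendsto_compose) (intro tendsto_intros t)
        then have "(\<lambda>n. h (t n + x) - h x) \<longlonglongrightarrow> h (0 + x) - h x" by (intro tendsto_intros)
        then have *: "(\<lambda>n. h (t n + x) - h x) \<longlonglongrightarrow> 0" by simp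
        show "(\<lambda>n. if \<bar>t n\<bar> \<le> 1 then h (t n + x) - h x else 0) \<longlonglongrightarrow> 0"
          by (rule Lim_null_comparison[OF _ tendsto_norm_zero[OF *]]) auto
      qed
    qed measurable
    then have "eventually (\<lambda>n. nsq (\<lambda>x. if \<bar>t n\<bar> \<le> 1 then h (t n + x) - h x else 0) < ennreal (e/10)) sequentially"
      using e by (intro order_tendstoD) auto
    moreover have "eventually (\<lambda>n. \<bar>t n\<bar> < 1) sequentially"
      using tendsto_rabs_zero[OF t] by (rule order_tendstoD) simp
    ultimately have "eventually (\<lambda>n. nsq (\<lambda>x. \<phi> (t n + x) - \<phi> x) \<le> ennreal e) sequentially"
    proof eventually_elim
      case (elim n)
      have tr: "nsq (\<lambda>x. \<phi> (t n + x) - h (t n + x)) = nsq (\<lambda>x. \<phi> x - h x)"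
        using nsq_affine[of "\<lambda>x. \<phi> x - h x" 1 "t n"] by simp
      have ht: "nsq (\<lambda>x. h (t n + x) - h x) \<le> ennreal (e/10)" using elim by simp
      have "nsq (\<lambda>x. \<phi> (t n + x) - \<phi> x) \<le> 2 * nsq (\<lambda>x. \<phi> (t n + x) - h (t n + x)) + 2 * nsq (\<lambda>x. h (t n + x) - \<phi> x)"
        by (rule nsq_diff_triangle) measurable
      also have "\<dots> \<le> 2 * nsq (\<lambda>x. \<phi> (t n + x) - h (t n + x)) + 2 * (2 * nsq (\<lambda>x. h (t n + x) - h x) + 2 * nsq (\<lambda>x. h x - \<phi> x))"
        by (intro add_left_mono mult_left_mono nsq_diff_triangle) auto
      also have "\<dots> \<le> 2 * ennreal (e/10) + 2 * (2 * ennreal (e/10) + 2 * ennreal (e/10))"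
        using a ht unfolding tr nsq_diff_commute[of h \<phi>] by (intro add_mono mult_left_mono) auto
      also have "\<dots> = ennreal (2 * (e/10) + 2 * (2 * (e/10) + 2 * (e/10)))"
        using e by (simp add: ennreal_double_add del: ennreal_plus)
      also have "\<dots> = ennreal e" by simp
      finally show ?case .
    qed
    then show "limsup (\<lambda>n. nsq (\<lambda>x. \<phi> (t n + x) - \<phi> x)) \<le> 0 + ennreal e"
      by (simp add: Limsup_bounded)
  qed
qed auto

section \<open>Fourier transform, convolution and Plancherel\<close>

text \<open>Unnormalised, with the sign convention of \<open>trunc_FT\<close>; this is where the
  factors 2 pi below come from.\<close>

definition FT :: "(real \<Rightarrow> complex) \<Rightarrow> real \<Rightarrow> complex" where
  "FT a \<xi> = (LINT x|lborel. a x * cis (- x * \<xi>))"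

lemma trunc_FT_eq: "trunc_FT n \<phi> = FT (cut n \<phi>)"
  by (simp add: trunc_FT_def FT_def cut_def set_lebesgue_integral_def fun_eq_iff)

lemma measurable_cis [measurable]: "cis \<in> borel_measurable borel"
  by (intro borel_measurable_continuous_onI continuous_intros)

lemma measurable_cnj [measurable]: "cnj \<in> borel_measurable borel"
  by (intro borel_measurable_continuous_onI continuous_intros)

lemma measurable_FT [measurable]:
  assumes [measurable]: "a \<in> borel_measurable borel"
  shows "FT a \<in> borel_measurable borel"
  unfolding FT_def by measurable

lemma integrable_mult_cis:
  assumes "integrable lborel a"
  shows "integrable lborel (\<lambda>x::real. a x * cis (- x * \<xi>))"
  by (rule Bochner_Integration.integrable_bound[OF assms])
     (use assms in \<open>auto simp: norm_mult\<close>)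

lemma FT_add:
  "integrable lborel a \<Longrightarrow> integrable lborel b \<Longrightarrow> FT (\<lambda>x. a x + b x) \<xi> = FT a \<xi> + FT b \<xi>"
  unfolding FT_def distrib_right by (intro Bochner_Integration.integral_add integrable_mult_cis)

lemma FT_diff:
  "integrable lborel a \<Longrightarrow> integrable lborel b \<Longrightarrow> FT (\<lambda>x. a x - b x) \<xi> = FT a \<xi> - FT b \<xi>"
  unfolding FT_def left_diff_distrib by (intro Bochner_Integration.integral_diff integrable_mult_cis)

lemma cmod_FT_le: "cmod (FT a \<xi>) \<le> (LINT x|lborel. cmod (a x))"
proof -
  have "cmod (FT a \<xi>) \<le> (LINT x|lborel. cmod (a x * cis (- x * \<xi>)))"
    unfolding FT_def by (rule integral_norm_bound)
  then show ?thesis by (simp add: norm_mult)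
qed

text \<open>Fubini for a(x) b(\<xi>) e^(-ix\<xi>), which is absolutely integrable on the plane. It
  serves both to test against Gaussians and to identify the adjoint of the transform.\<close>

lemma FT_mult_formula:
  assumes a: "integrable lborel a" and b: "integrable lborel b"
  shows "(LINT \<xi>|lborel. FT a \<xi> * b \<xi>) = (LINT x|lborel. a x * FT b x)"
proof -
  have [measurable]: "a \<in> borel_measurable borel" "b \<in> borel_measurable borel"
    using a b by auto
  have F: "integrable (lborel \<Otimes>\<^sub>M lborel) (\<lambda>(x, \<xi>). a x * b \<xi> * cis (- x * \<xi>))"
  proof (rule lborel_pair.Fubini_integrable)
    show "integrable lborel (\<lambda>x. LINT y|lborel. norm (case (x, y) of (x, \<xi>) \<Rightarrow> a x * b \<xi> * cis (- x * \<xi>)))"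
      using a by (simp add: norm_mult)
    have "integrable lborel (\<lambda>\<xi>. a x * (b \<xi> * cis (- \<xi> * x)))" for x
      by (intro integrable_mult_right integrable_mult_cis b)
    then show "AE x in lborel. integrable lborel (\<lambda>y. case (x, y) of (x, \<xi>) \<Rightarrow> a x * b \<xi> * cis (- x * \<xi>))"
      by (simp add: mult_ac)
  qed measurable
  have "(LINT \<xi>|lborel. FT a \<xi> * b \<xi>) = (LINT \<xi>|lborel. LINT x|lborel. a x * b \<xi> * cis (- x * \<xi>))"
    unfolding FT_def by (intro Bochner_Integration.integral_cong refl) (simp add: mult_ac flip: integral_mult_right_zero)
  also have "\<dots> = (LINT x|lborel. LINT \<xi>|lborel. a x * b \<xi> * cis (- x * \<xi>))"
    using lborel_pair.Fubini_integral[OF F] .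
  also have "\<dots> = (LINT x|lborel. a x * FT b x)"
    unfolding FT_def by (intro Bochner_Integration.integral_cong refl) (simp add: mult_ac flip: integral_mult_right_zero)
  finally show ?thesis .
qed

lemma integrable_mult_L2R:
  assumes "\<phi> \<in> L2R" "\<psi> \<in> L2R"
  shows "integrable lborel (\<lambda>x. \<phi> x * \<psi> x)"
proof -
  have [measurable]: "\<phi> \<in> borel_measurable borel" "\<psi> \<in> borel_measurable borel"
    using assms L2R_iff by auto
  show ?thesis
  proof (rule Bochner_Integration.integrable_bound)
    show "integrable lborel (\<lambda>x. (cmod (\<phi> x))\<^sup>2 + (cmod (\<psi> x))\<^sup>2)"
      using assms by (intro Bochner_Integration.integrable_add) (auto simp: L2R_def)
    show "AE x in lborel. norm (\<phi> x * \<psi> x) \<le> norm ((cmod (\<phi> x))\<^sup>2 + (cmod (\<psi> x))\<^sup>2)"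
    proof (rule AE_I2)
      fix x
      have "0 \<le> (cmod (\<phi> x))\<^sup>2 + (cmod (\<psi> x))\<^sup>2" by simp
      moreover have "0 \<le> cmod (\<phi> x) * cmod (\<psi> x)" by simp
      ultimately show "norm (\<phi> x * \<psi> x) \<le> norm ((cmod (\<phi> x))\<^sup>2 + (cmod (\<psi> x))\<^sup>2)"
        using sum_squares_bound[of "cmod (\<phi> x)" "cmod (\<psi> x)"] unfolding norm_mult real_norm_def by linarith
    qed
  qed measurable
qed

lemma L2R_Cauchy_Schwarz:
  assumes "\<phi> \<in> L2R" "\<psi> \<in> L2R"
  shows "ennreal ((cmod (LINT x|lborel. \<phi> x * \<psi> x))\<^sup>2) \<le> nsq \<phi> * nsq \<psi>"
proof -
  have [measurable]: "\<phi> \<in> borel_measurable borel" "\<psi> \<in> borel_measurable borel"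
    using assms L2R_iff by auto
  have "ennreal (cmod (LINT x|lborel. \<phi> x * \<psi> x)) \<le> (\<integral>\<^sup>+x. ennreal (cmod (\<phi> x * \<psi> x)) \<partial>lborel)"
    using integral_norm_bound_ennreal[OF integrable_mult_L2R[OF assms]] by simp
  also have "\<dots> = (\<integral>\<^sup>+x. ennreal (cmod (\<phi> x)) * ennreal (cmod (\<psi> x)) \<partial>lborel)"
    by (simp add: norm_mult ennreal_mult)
  finally have "(ennreal (cmod (LINT x|lborel. \<phi> x * \<psi> x)))\<^sup>2 \<le> (\<integral>\<^sup>+x. ennreal (cmod (\<phi> x)) * ennreal (cmod (\<psi> x)) \<partial>lborel)\<^sup>2"
    by (rule power_mono) simp
  also have "\<dots> \<le> (\<integral>\<^sup>+x. (ennreal (cmod (\<phi> x)))\<^sup>2 \<partial>lborel) * (\<integral>\<^sup>+x. (ennreal (cmod (\<psi> x)))\<^sup>2 \<partial>lborel)"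
    by (rule Cauchy_Schwarz_nn_integral) measurable
  finally show ?thesis by (simp add: nsq_def ennreal_power)
qed

text \<open>The complex measure convolved with is the image of \<open>k\<close> times
  \<open>M\<close> under \<open>l\<close>. Keeping it in parametrised form avoids constructing that
  image, and allows two uses: the autocorrelation in Plancherel's theorem, and the operators of the
  integral equation, where s ranges over the domain of f.\<close>

locale conv_kernel = sigma_finite_measure M for M :: "'b measure" +
  fixes k :: "'b \<Rightarrow> complex" and l :: "'b \<Rightarrow> real"
  assumes k_integrable: "integrable M k" and l_measurable [measurable]: "l \<in> borel_measurable M"
begin

definition conv :: "(real \<Rightarrow> complex) \<Rightarrow> real \<Rightarrow> complex" where
  "conv \<phi> t = (LINT s|M. k s * \<phi> (t - l s))"

definition multiplier :: "real \<Rightarrow> complex" where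
  "multiplier \<xi> = (LINT s|M. k s * cis (- \<xi> * l s))"

lemma k_measurable [measurable]: "k \<in> borel_measurable M"
  using k_integrable by auto

lemma measurable_conv [measurable]:
  assumes [measurable]: "\<phi> \<in> borel_measurable borel"
  shows "conv \<phi> \<in> borel_measurable borel"
  unfolding conv_def by measurable

lemma conv_integrable_product:
  assumes "integrable lborel \<phi>"
  shows "integrable (M \<Otimes>\<^sub>M lborel) (\<lambda>(s, t). k s * \<phi> (t - l s))"
proof -
  interpret P: pair_sigma_finite M lborel ..
  have [measurable]: "\<phi> \<in> borel_measurable borel" using assms by auto
  have sh: "integrable lborel (\<lambda>t. \<phi> (t - l s))" for s
    using lborel_integrable_real_affine[OF assms, of 1 "- l s"] by simp
  have nsh: "(LINT t|lborel. norm (\<phi> (t - l s))) = (LINT t|lborel. norm (\<phi> t))" for s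
    using lborel_integral_real_affine[of 1 "\<lambda>x. norm (\<phi> x)" "- l s"] by simp
  show ?thesis
  proof (rule P.Fubini_integrable)
    show "integrable M (\<lambda>s. LINT t|lborel. norm (case (s, t) of (s, t) \<Rightarrow> k s * \<phi> (t - l s)))"
      using k_integrable by (simp add: norm_mult nsh)
    show "AE s in M. integrable lborel (\<lambda>t. case (s, t) of (s, t) \<Rightarrow> k s * \<phi> (t - l s))"
      using sh by simp
  qed measurable
qed

lemma conv_integrable:
  assumes "integrable lborel \<phi>"
  shows "integrable lborel (conv \<phi>)"
proof -
  interpret P: pair_sigma_finite M lborel ..
  show ?thesis
    using P.integrable_snd[of "\<lambda>s t. k s * \<phi> (t - l s)"] conv_integrable_product[OF assms] by (simp add: conv_def[abs_def])
qed

lemma FT_conv: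
  assumes "integrable lborel \<phi>"
  shows "FT (conv \<phi>) \<xi> = multiplier \<xi> * FT \<phi> \<xi>"
proof -
  interpret P: pair_sigma_finite M lborel ..
  have [measurable]: "\<phi> \<in> borel_measurable borel" using assms by auto
  have I: "integrable (M \<Otimes>\<^sub>M lborel) (\<lambda>(s, t). k s * \<phi> (t - l s) * cis (- t * \<xi>))"
    by (rule Bochner_Integration.integrable_bound[OF conv_integrable_product[OF assms]])
       (auto simp: norm_mult)
  have "FT (conv \<phi>) \<xi> = (LINT t|lborel. LINT s|M. k s * \<phi> (t - l s) * cis (- t * \<xi>))"
    unfolding FT_def conv_def by simp
  also have "\<dots> = (LINT s|M. LINT t|lborel. k s * \<phi> (t - l s) * cis (- t * \<xi>))"
    using P.Fubini_integral[OF I] .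
  also have "\<dots> = (LINT s|M. k s * cis (- \<xi> * l s) * FT \<phi> \<xi>)"
  proof (rule Bochner_Integration.integral_cong[OF refl])
    fix s
    have "(LINT t|lborel. k s * \<phi> (t - l s) * cis (- t * \<xi>)) =
        (LINT t|lborel. k s * \<phi> t * cis (- (l s + t) * \<xi>))"
      using lborel_integral_real_affine[of 1 "\<lambda>t. k s * \<phi> (t - l s) * cis (- t * \<xi>)" "l s"] by simp
    also have "\<dots> = (LINT t|lborel. (k s * cis (- \<xi> * l s)) * (\<phi> t * cis (- t * \<xi>)))"
    proof (rule Bochner_Integration.integral_cong[OF refl])
      fix t
      have "cis (- (l s + t) * \<xi>) = cis (- \<xi> * l s) * cis (- t * \<xi>)"
        unfolding cis_mult by (simp add: algebra_simps)
      then show "k s * \<phi> t * cis (- (l s + t) * \<xi>) = (k s * cis (- \<xi> * l s)) * (\<phi> t * cis (- t * \<xi>))"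
        by (simp add: mult_ac)
    qed
    also have "\<dots> = k s * cis (- \<xi> * l s) * FT \<phi> \<xi>"
      unfolding FT_def by (rule integral_mult_right_zero)
    finally show "(LINT t|lborel. k s * \<phi> (t - l s) * cis (- t * \<xi>)) = k s * cis (- \<xi> * l s) * FT \<phi> \<xi>" .
  qed
  also have "\<dots> = multiplier \<xi> * FT \<phi> \<xi>"
    unfolding multiplier_def by (rule integral_mult_left_zero)
  finally show ?thesis .
qed

text \<open>Tonelli and translation invariance. The identity gives both the a.e. convergence of the
  convolution integral and its L2 bound.\<close>

lemma nn_integral_conv_sq:
  assumes [measurable]: "\<phi> \<in> borel_measurable borel"
  shows "(\<integral>\<^sup>+t. (\<integral>\<^sup>+s. ennreal (cmod (k s) * (cmod (\<phi> (t - l s)))\<^sup>2) \<partial>M) \<partial>lborel)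
    = (\<integral>\<^sup>+s. ennreal (cmod (k s)) \<partial>M) * nsq \<phi>"
proof -
  interpret P: pair_sigma_finite M lborel ..
  have sh: "(\<integral>\<^sup>+t. ennreal ((cmod (\<phi> (t - l s)))\<^sup>2) \<partial>lborel) = nsq \<phi>" for s
    using nsq_affine[of \<phi> 1 "- l s"] by (simp add: nsq_def)
  have "(\<integral>\<^sup>+t. (\<integral>\<^sup>+s. ennreal (cmod (k s) * (cmod (\<phi> (t - l s)))\<^sup>2) \<partial>M) \<partial>lborel)
    = (\<integral>\<^sup>+s. (\<integral>\<^sup>+t. ennreal (cmod (k s) * (cmod (\<phi> (t - l s)))\<^sup>2) \<partial>lborel) \<partial>M)"
    by (rule P.Fubini') measurable
  also have "\<dots> = (\<integral>\<^sup>+s. ennreal (cmod (k s)) * nsq \<phi> \<partial>M)"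
    by (simp add: ennreal_mult nn_integral_cmult sh)
  also have "\<dots> = (\<integral>\<^sup>+s. ennreal (cmod (k s)) \<partial>M) * nsq \<phi>"
    by (rule nn_integral_multc) measurable
  finally show ?thesis .
qed

lemma k_nn_integral_finite: "(\<integral>\<^sup>+s. ennreal (cmod (k s)) \<partial>M) < \<infinity>"
  using k_integrable by (simp add: integrable_iff_bounded)

text \<open>Since y \<le> 1 + y^2, the integrand is dominated by |k| + |k| |\<phi>|^2, whose second
  term has a finite integral for almost every t.\<close>

lemma AE_integrable_conv:
  assumes \<phi>: "\<phi> \<in> L2R"
  shows "AE t in lborel. integrable M (\<lambda>s. k s * \<phi> (t - l s))"
proof -
  have [measurable]: "\<phi> \<in> borel_measurable borel" using \<phi> L2R_iff by auto
  have "AE t in lborel. (\<integral>\<^sup>+s. ennreal (cmod (k s) * (cmod (\<phi> (t - l s)))\<^sup>2) \<partial>M) \<noteq> \<infinity>"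
    using \<phi> k_nn_integral_finite nn_integral_conv_sq[of \<phi>]
    by (intro nn_integral_PInf_AE) (auto simp: L2R_iff ennreal_mult_eq_top_iff)
  then show ?thesis
  proof eventually_elim
    case (elim t)
    then have "integrable M (\<lambda>s. cmod (k s) * (cmod (\<phi> (t - l s)))\<^sup>2)"
      by (simp add: integrable_iff_bounded top.not_eq_extremum)
    then have "integrable M (\<lambda>s. cmod (k s) + cmod (k s) * (cmod (\<phi> (t - l s)))\<^sup>2)"
      using k_integrable by (intro Bochner_Integration.integrable_add) auto
    then show ?case
    proof (rule Bochner_Integration.integrable_bound)
      show "AE s in M. norm (k s * \<phi> (t - l s)) \<le> norm (cmod (k s) + cmod (k s) * (cmod (\<phi> (t - l s)))\<^sup>2)"
      proof (rule AE_I2)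
        fix s
        have "cmod (\<phi> (t - l s)) \<le> 1 + (cmod (\<phi> (t - l s)))\<^sup>2"
          using sum_squares_bound[of 1 "cmod (\<phi> (t - l s))"] norm_ge_zero[of "\<phi> (t - l s)"] unfolding power2_eq_square by linarith
        then have "cmod (k s) * cmod (\<phi> (t - l s)) \<le> cmod (k s) * (1 + (cmod (\<phi> (t - l s)))\<^sup>2)"
          by (intro mult_left_mono) auto
        moreover have "0 \<le> cmod (k s) + cmod (k s) * (cmod (\<phi> (t - l s)))\<^sup>2" by simp
        ultimately show "norm (k s * \<phi> (t - l s)) \<le> norm (cmod (k s) + cmod (k s) * (cmod (\<phi> (t - l s)))\<^sup>2)"
          unfolding norm_mult real_norm_def by (simp add: distrib_left)
      qed
    qed measurable
  qed
qed

text \<open>Young's inequality for L1 and L2: Cauchy-Schwarz after splitting |k| |\<phi>| as sqrt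
  |k| times sqrt |k| |\<phi>|.\<close>

lemma nsq_conv_le:
  assumes \<phi>: "\<phi> \<in> L2R"
  shows "nsq (conv \<phi>) \<le> (\<integral>\<^sup>+s. ennreal (cmod (k s)) \<partial>M)\<^sup>2 * nsq \<phi>"
proof -
  have [measurable]: "\<phi> \<in> borel_measurable borel" using \<phi> L2R_iff by auto
  let ?K = "\<integral>\<^sup>+s. ennreal (cmod (k s)) \<partial>M"
  have "nsq (conv \<phi>) \<le> (\<integral>\<^sup>+t. ?K * (\<integral>\<^sup>+s. ennreal (cmod (k s) * (cmod (\<phi> (t - l s)))\<^sup>2) \<partial>M) \<partial>lborel)"
    unfolding nsq_def
  proof (rule nn_integral_mono_AE, use AE_integrable_conv[OF \<phi>] in eventually_elim)
    case (elim t)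
    have "ennreal (cmod (conv \<phi> t)) \<le> (\<integral>\<^sup>+s. ennreal (cmod (k s * \<phi> (t - l s))) \<partial>M)"
      unfolding conv_def using integral_norm_bound_ennreal[OF elim] by simp
    also have "\<dots> = (\<integral>\<^sup>+s. ennreal (sqrt (cmod (k s))) * ennreal (sqrt (cmod (k s)) * cmod (\<phi> (t - l s))) \<partial>M)"
      by (intro nn_integral_cong) (simp add: norm_mult flip: ennreal_mult mult.assoc)
    finally have "(ennreal (cmod (conv \<phi> t)))\<^sup>2 \<le> (\<integral>\<^sup>+s. ennreal (sqrt (cmod (k s))) * ennreal (sqrt (cmod (k s)) * cmod (\<phi> (t - l s))) \<partial>M)\<^sup>2"
      by (rule power_mono) simp
    also have "\<dots> \<le> (\<integral>\<^sup>+s. (ennreal (sqrt (cmod (k s))))\<^sup>2 \<partial>M) * (\<integral>\<^sup>+s. (ennreal (sqrt (cmod (k s)) * cmod (\<phi> (t - l s))))\<^sup>2 \<partial>M)"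
      by (rule Cauchy_Schwarz_nn_integral) measurable
    finally show ?case by (simp add: ennreal_power power_mult_distrib)
  qed
  also have "\<dots> = ?K * (?K * nsq \<phi>)"
    by (subst nn_integral_cmult) (auto simp: nn_integral_conv_sq)
  finally show ?thesis by (simp add: power2_eq_square mult_ac)
qed

lemma L2R_conv: "\<phi> \<in> L2R \<Longrightarrow> conv \<phi> \<in> L2R"
  using nsq_conv_le[of \<phi>] k_nn_integral_finite
  by (auto simp: L2R_iff ennreal_mult_less_top power_less_top_ennreal intro: le_less_trans)

text \<open>Asserted only almost everywhere: where an integrand is not integrable its integral has
  the default value 0, and linearity may fail.\<close>

lemma conv_diff_AE:
  assumes "\<phi> \<in> L2R" "\<psi> \<in> L2R"
  shows "AE t in lborel. conv (\<lambda>x. \<phi> x - \<psi> x) t = conv \<phi> t - conv \<psi> t"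
  using AE_integrable_conv[OF assms(1)] AE_integrable_conv[OF assms(2)]
  by eventually_elim (simp add: conv_def right_diff_distrib)

lemma cmod_multiplier_le: "cmod (multiplier \<xi>) \<le> (LINT s|M. cmod (k s))"
proof -
  have "cmod (multiplier \<xi>) \<le> (LINT s|M. cmod (k s * cis (- \<xi> * l s)))"
    unfolding multiplier_def by (rule integral_norm_bound)
  then show ?thesis by (simp add: norm_mult)
qed

text \<open>Dominated convergence with bound |k|. Continuity is what spreads a small value of the
  multiplier over an interval in \<open>conv_surjective_iff\<close>.\<close>

lemma isCont_multiplier: "isCont multiplier \<xi>"
  unfolding continuous_at_sequentially
proof safe
  fix X assume X: "X \<longlonglongrightarrow> \<xi>"
  show "(multiplier \<circ> X) \<longlonglongrightarrow> multiplier \<xi>"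
    unfolding comp_def multiplier_def
    by (rule integral_dominated_convergence[where w="\<lambda>s. cmod (k s)"])
       (use k_integrable in \<open>auto intro!: tendsto_intros X simp: norm_mult\<close>)
qed

lemma measurable_multiplier [measurable]: "multiplier \<in> borel_measurable borel"
  by (intro borel_measurable_continuous_onI continuous_at_imp_continuous_on ballI isCont_multiplier)

end

section \<open>Plancherel's theorem for integrable, square-integrable functions\<close>

lemma integral_std_normal_density_cis:
  "(LINT y|lborel. complex_of_real (std_normal_density y) * cis (- y * u)) = complex_of_real (exp (- u\<^sup>2 / 2))"
proof -
  have "(LINT y|lborel. complex_of_real (std_normal_density y) * cis (- y * u)) = char std_normal_distribution (- u)"
    unfolding char_def by (subst integral_density) (auto simp: cis_conv_exp scaleR_conv_of_real mult_ac)
  then show ?thesis by (simp add: char_std_normal_distribution)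
qed

lemma integrable_std_normal_density: "integrable lborel std_normal_density"
  by simp

text \<open>The autocorrelation of \<open>a\<close> is continuous, has the value \<open>nsq a\<close> at 0, and its Fourier transform
  is the square of \<open>cmod (FT a)\<close>; both sides of the identity are limits of its pairing with Gaussians.\<close>

theorem Plancherel:
  assumes a1: "integrable lborel a" and a2: "a \<in> L2R"
  shows "nsq (FT a) = ennreal (2 * pi) * nsq a"
proof -
  have [measurable]: "a \<in> borel_measurable borel" using a1 by auto
  have a2': "(\<lambda>s. cnj (a s)) \<in> L2R"
    using a2 by (simp add: L2R_iff nsq_def)
  have nsq_cnj: "nsq (\<lambda>s. cnj (a s)) = nsq a" by (simp add: nsq_def)
  \<comment> \<open>With displacement -s the convolution at t is the integral of cnj (a s) a(t + s),
    the autocorrelation, and the multiplier is the conjugate of \<open>FT a\<close>.\<close>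
  interpret A: conv_kernel lborel "\<lambda>s. cnj (a s)" "\<lambda>s. - s"
    by unfold_locales (use a1 in auto)
  let ?A = "A.conv a"
  obtain c where c: "c \<ge> 0" "nsq a = ennreal c"
    using a2 by (auto simp: L2R_iff less_top elim: ennreal_cases)
  have mult: "A.multiplier \<xi> = cnj (FT a \<xi>)" for \<xi>
  proof -
    have "A.multiplier \<xi> = (LINT s|lborel. cnj (a s * cis (- s * \<xi>)))"
      unfolding A.multiplier_def by (simp add: cis_cnj mult_ac)
    also have "\<dots> = cnj (FT a \<xi>)"
      unfolding FT_def by (rule Bochner_Integration.integral_cnj)
    finally show ?thesis .
  qed
  have sq: "complex_of_real ((cmod z)\<^sup>2) = cnj z * z" for z
    by (simp only: complex_norm_square mult.commute)
  have FTA: "FT ?A \<xi> = complex_of_real ((cmod (FT a \<xi>))\<^sup>2)" for \<xi>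
    unfolding A.FT_conv[OF a1] mult sq ..
  have A0: "?A 0 = complex_of_real c"
  proof -
    have "?A 0 = (LINT s|lborel. complex_of_real ((cmod (a s))\<^sup>2))"
      unfolding A.conv_def sq by simp
    also have "\<dots> = complex_of_real (LINT s|lborel. (cmod (a s))\<^sup>2)"
      by (rule integral_complex_of_real)
    also have "(LINT s|lborel. (cmod (a s))\<^sup>2) = c"
      using c by (intro integral_eq_nn_integral[THEN trans]) (auto simp: nsq_def)
    finally show ?thesis .
  qed
  have sh: "(\<lambda>s. a (t + s)) \<in> L2R" for t
    using a2 nsq_affine[of a 1 t] by (simp add: L2R_iff)
  have Ab: "cmod (?A t) \<le> c" for t
  proof -
    have "ennreal ((cmod (?A t))\<^sup>2) \<le> nsq a * nsq a"
      using L2R_Cauchy_Schwarz[OF a2' sh[of t]] nsq_affine[of a 1 t]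
      by (simp add: A.conv_def nsq_cnj)
    also have "nsq a * nsq a = ennreal (c\<^sup>2)" unfolding c(2) power2_eq_square by (rule ennreal_mult[symmetric]; fact c)
    finally have "(cmod (?A t))\<^sup>2 \<le> c\<^sup>2" by simp
    then show ?thesis using c(1) by (rule power2_le_imp_le)
  qed
  have Acont: "(\<lambda>n. ?A (t n)) \<longlonglongrightarrow> ?A 0" if t: "t \<longlonglongrightarrow> 0" for t :: "nat \<Rightarrow> real"
  proof -
    have d: "(\<lambda>s. a (t n + s) - a s) \<in> L2R" for n by (intro L2R_diff sh a2)
    \<comment> \<open>Continuity at 0 is reduced by this formula and Cauchy-Schwarz to the L2
      continuity of translations of \<open>a\<close>.\<close>
    have eq: "?A (t n) - ?A 0 = (LINT s|lborel. cnj (a s) * (a (t n + s) - a s))" for n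
    proof -
      have "(LINT s|lborel. cnj (a s) * (a (t n + s) - a s)) =
          (LINT s|lborel. cnj (a s) * a (t n + s)) - (LINT s|lborel. cnj (a s) * a s)"
        unfolding right_diff_distrib
        by (intro Bochner_Integration.integral_diff integrable_mult_L2R a2' sh a2)
      then show ?thesis by (simp add: A.conv_def)
    qed
    have "(\<lambda>n. ennreal ((cmod (?A (t n) - ?A 0))\<^sup>2)) \<longlonglongrightarrow> 0"
    proof (rule tendsto_sandwich[where f="\<lambda>_. 0" and h="\<lambda>n. nsq a * nsq (\<lambda>s. a (t n + s) - a s)"])
      show "(\<lambda>n. nsq a * nsq (\<lambda>s. a (t n + s) - a s)) \<longlonglongrightarrow> 0"
        using ennreal_tendsto_cmult[OF _ translation_continuous_L2[OF a2 t], of "nsq a"] c(2)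
        by simp
      show "\<forall>\<^sub>F n in sequentially. ennreal ((cmod (?A (t n) - ?A 0))\<^sup>2) \<le> nsq a * nsq (\<lambda>s. a (t n + s) - a s)"
        unfolding eq using L2R_Cauchy_Schwarz[OF a2' d] unfolding nsq_cnj by (intro always_eventually allI)
    qed auto
    then have "(\<lambda>n. (cmod (?A (t n) - ?A 0))\<^sup>2) \<longlonglongrightarrow> 0"
      unfolding ennreal_0[symmetric] by (rule tendsto_ennrealD) (auto intro: always_eventually)
    then have "(\<lambda>n. sqrt ((cmod (?A (t n) - ?A 0))\<^sup>2)) \<longlonglongrightarrow> sqrt 0"
      by (rule tendsto_real_sqrt)
    then have "(\<lambda>n. cmod (?A (t n) - ?A 0)) \<longlonglongrightarrow> 0" by simp
    then show ?thesis by (rule LIM_zero_cancel[OF tendsto_norm_zero_cancel])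
  qed
  \<comment> \<open>Gaussians of width n + 1, increasing to 1 as n grows; \<open>Suc\<close> avoids
    division by 0. As multiples of the normal density they have explicit transforms.\<close>
  define e where "e n \<xi> = exp (- (\<xi> / real (Suc n))\<^sup>2 / 2)" for n \<xi>
  have e_snd: "e n \<xi> = sqrt (2 * pi) * std_normal_density (\<xi> / real (Suc n))" for n \<xi>
    by (simp add: e_def std_normal_density_def)
  have [measurable]: "e n \<in> borel_measurable borel" for n unfolding e_def by measurable
  have snd_cx: "integrable lborel (\<lambda>y. complex_of_real (std_normal_density y))"
    by (intro integrable_of_real integrable_std_normal_density)
  have e_int: "integrable lborel (\<lambda>\<xi>. complex_of_real (e n \<xi>))" for n
  proof -
    have "integrable lborel (\<lambda>\<xi>. complex_of_real (std_normal_density (0 + (1 / real (Suc n)) * \<xi>)))"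
      by (rule lborel_integrable_real_affine[OF snd_cx]) simp
    then have "integrable lborel (\<lambda>\<xi>. complex_of_real (sqrt (2*pi)) * complex_of_real (std_normal_density (0 + (1 / real (Suc n)) * \<xi>)))"
      by (rule integrable_mult_right)
    then show ?thesis by (simp add: e_snd)
  qed
  have FTe: "FT (\<lambda>\<xi>. complex_of_real (e n \<xi>)) x = complex_of_real (2 * pi * (real (Suc n) * std_normal_density (real (Suc n) * x)))" for n x
  proof -
    let ?N = "real (Suc n)"
    have "FT (\<lambda>\<xi>. complex_of_real (e n \<xi>)) x = ?N *\<^sub>R (LINT y|lborel. complex_of_real (e n (0 + ?N * y)) * cis (- (0 + ?N * y) * x))"
      unfolding FT_def by (subst lborel_integral_real_affine[of ?N _ 0]) auto
    also have "(LINT y|lborel. complex_of_real (e n (0 + ?N * y)) * cis (- (0 + ?N * y) * x))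
        = (LINT y|lborel. complex_of_real (sqrt (2 * pi)) * (complex_of_real (std_normal_density y) * cis (- y * (?N * x))))"
      by (intro Bochner_Integration.integral_cong refl) (simp add: e_snd mult_ac del: of_nat_Suc)
    also have "\<dots> = complex_of_real (sqrt (2 * pi)) * complex_of_real (exp (- (?N * x)\<^sup>2 / 2))"
      by (subst integral_mult_right_zero) (simp only: integral_std_normal_density_cis)
    also have "?N *\<^sub>R \<dots> = complex_of_real (?N * (sqrt (2 * pi) * exp (- (?N * x)\<^sup>2 / 2)))"
      by (simp only: scaleR_conv_of_real of_real_mult)
    also have "sqrt (2 * pi) * exp (- (?N * x)\<^sup>2 / 2) = 2 * pi * std_normal_density (?N * x)"
      by (simp add: std_normal_density_def field_simps del: of_nat_Suc)
    finally show ?thesis by (simp only: mult_ac)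
  qed
  define I where "I n = (LINT \<xi>|lborel. (cmod (FT a \<xi>))\<^sup>2 * e n \<xi>)" for n
  have Iint: "integrable lborel (\<lambda>\<xi>. (cmod (FT a \<xi>))\<^sup>2 * e n \<xi>)" for n
  proof (rule Bochner_Integration.integrable_bound)
    let ?B = "LINT x|lborel. cmod (a x)"
    show "integrable lborel (\<lambda>\<xi>. ?B\<^sup>2 * cmod (complex_of_real (e n \<xi>)))"
      using integrable_norm[OF e_int] by (rule integrable_mult_right)
    show "AE \<xi> in lborel. norm ((cmod (FT a \<xi>))\<^sup>2 * e n \<xi>) \<le> norm (?B\<^sup>2 * cmod (complex_of_real (e n \<xi>)))"
      by (auto simp: abs_mult e_def intro!: mult_right_mono power_mono cmod_FT_le)
  qed measurable
  \<comment> \<open>The transform of the n-th Gaussian is 2 pi times a probability density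
    concentrating at 0. Rescaling by n + 1 makes the density independent of n and moves n into the
    argument of the bounded autocorrelation, ready for dominated convergence.\<close>
  have I_eq: "complex_of_real (I n) = 2 * pi * (LINT y|lborel. std_normal_density y * ?A (y / real (Suc n)))" for n
  proof -
    let ?N = "real (Suc n)"
    have "complex_of_real (I n) = (LINT \<xi>|lborel. FT ?A \<xi> * complex_of_real (e n \<xi>))"
      unfolding I_def FTA by (subst integral_complex_of_real[symmetric]) simp
    also have "\<dots> = (LINT x|lborel. ?A x * FT (\<lambda>\<xi>. complex_of_real (e n \<xi>)) x)"
      by (rule FT_mult_formula[OF A.conv_integrable[OF a1] e_int])
    also have "\<dots> = \<bar>1 / ?N\<bar> *\<^sub>R (LINT x|lborel. ?A (0 + 1 / ?N * x) * FT (\<lambda>\<xi>. complex_of_real (e n \<xi>)) (0 + 1 / ?N * x))"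
      by (rule lborel_integral_real_affine) simp
    also have "\<dots> = (LINT x|lborel. ?A (x / ?N) * FT (\<lambda>\<xi>. complex_of_real (e n \<xi>)) (x / ?N)) /\<^sub>R ?N"
      by (simp add: inverse_eq_divide del: of_nat_Suc)
    also have "\<dots> = (LINT x|lborel. (?A (x / ?N) * FT (\<lambda>\<xi>. complex_of_real (e n \<xi>)) (x / ?N)) /\<^sub>R ?N)"
      by (rule integral_scaleR_right[symmetric])
    also have "\<dots> = (LINT x|lborel. (2 * pi) * (std_normal_density x * ?A (x / ?N)))"
      unfolding FTe by (intro Bochner_Integration.integral_cong refl) (simp add: scaleR_conv_of_real field_simps del: of_nat_Suc)
    also have "\<dots> = 2 * pi * (LINT x|lborel. std_normal_density x * ?A (x / ?N))"
      by (rule integral_mult_right_zero)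
    finally show ?thesis .
  qed
  have "(\<lambda>n. LINT y|lborel. std_normal_density y * ?A (y / real (Suc n))) \<longlonglongrightarrow> (LINT y|lborel. std_normal_density y * ?A 0)"
  proof (rule integral_dominated_convergence[where w="\<lambda>y. std_normal_density y * c"])
    show "integrable lborel (\<lambda>y. std_normal_density y * c)" by simp
    show "AE y in lborel. (\<lambda>n. std_normal_density y * ?A (y / real (Suc n))) \<longlonglongrightarrow> std_normal_density y * ?A 0"
    proof (intro AE_I2 tendsto_mult tendsto_const Acont)
      fix y :: real
      show "(\<lambda>n. y / real (Suc n)) \<longlonglongrightarrow> 0"
        using LIMSEQ_Suc[OF lim_const_over_n[of y]] by simp
    qed
    show "AE y in lborel. norm (std_normal_density y * ?A (y / real (Suc n))) \<le> std_normal_density y * c" for n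
      by (auto simp: norm_mult intro!: mult_left_mono Ab simp del: of_nat_Suc)
  qed measurable
  also have "(LINT y|lborel. std_normal_density y * ?A 0) = c"
  proof -
    have "(LINT y|lborel. std_normal_density y * ?A 0) = (LINT y|lborel. complex_of_real (std_normal_density y * c))"
      by (simp add: A0)
    also have "\<dots> = complex_of_real (LINT y|lborel. std_normal_density y * c)"
      by (rule integral_complex_of_real)
    also have "(LINT y|lborel. std_normal_density y * c) = c" by simp
    finally show ?thesis .
  qed
  finally have "(\<lambda>n. complex_of_real (I n)) \<longlonglongrightarrow> complex_of_real (2 * pi) * complex_of_real c"
    unfolding I_eq by (rule tendsto_mult_left)
  then have "(\<lambda>n. complex_of_real (I n)) \<longlonglongrightarrow> complex_of_real (2 * pi * c)" by simp
  then have "I \<longlonglongrightarrow> 2 * pi * c" by (simp only: tendsto_of_real_iff)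
  then have lim1: "(\<lambda>n. ennreal (I n)) \<longlonglongrightarrow> ennreal (2 * pi * c)" by (rule tendsto_ennrealI)
  define F where "F n \<xi> = ennreal ((cmod (FT a \<xi>))\<^sup>2 * e n \<xi>)" for n \<xi>
  have F_nn: "integral\<^sup>N lborel (F n) = ennreal (I n)" for n
    unfolding F_def I_def using Iint by (intro nn_integral_eq_integral) (auto simp: e_def)
  \<comment> \<open>On the frequency side monotone convergence is used, because the integrability of
    the squared modulus of \<open>FT a\<close> is part of what is being proved.\<close>
  have F_inc: "incseq F"
  proof (intro incseq_SucI le_funI)
    fix n \<xi>
    have "\<bar>\<xi> / real (Suc (Suc n))\<bar> \<le> \<bar>\<xi> / real (Suc n)\<bar>"
      by (auto simp: abs_divide intro!: divide_left_mono)
    then have "(\<xi> / real (Suc (Suc n)))\<^sup>2 \<le> (\<xi> / real (Suc n))\<^sup>2"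
      by (simp only: abs_le_square_iff)
    then show "F n \<xi> \<le> F (Suc n) \<xi>"
      unfolding F_def e_def by (intro ennreal_leI mult_left_mono) (auto simp del: of_nat_Suc)
  qed
  have "(SUP n. F n \<xi>) = ennreal ((cmod (FT a \<xi>))\<^sup>2)" for \<xi>
  proof (rule LIMSEQ_unique[OF LIMSEQ_SUP])
    show "incseq (\<lambda>n. F n \<xi>)" using F_inc by (auto simp: incseq_def le_fun_def)
    have "(\<lambda>n. \<xi> / real (Suc n)) \<longlonglongrightarrow> 0"
      using LIMSEQ_Suc[OF lim_const_over_n[of \<xi>]] by simp
    then have "(\<lambda>n. (cmod (FT a \<xi>))\<^sup>2 * exp (- (\<xi> / real (Suc n))\<^sup>2 / 2)) \<longlonglongrightarrow> (cmod (FT a \<xi>))\<^sup>2 * exp (- 0\<^sup>2 / 2)"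
      by (intro tendsto_intros)  auto
    then show "(\<lambda>n. F n \<xi>) \<longlonglongrightarrow> ennreal ((cmod (FT a \<xi>))\<^sup>2)"
      unfolding F_def e_def by (intro tendsto_ennrealI) simp
  qed
  then have "nsq (FT a) = (\<integral>\<^sup>+ \<xi>. (SUP n. F n \<xi>) \<partial>lborel)" by (simp add: nsq_def)
  also have "\<dots> = (SUP n. integral\<^sup>N lborel (F n))"
    by (rule nn_integral_monotone_convergence_SUP[OF F_inc]) (simp add: F_def[abs_def])
  also have "\<dots> = ennreal (2 * pi * c)"
  proof (rule LIMSEQ_unique[OF LIMSEQ_SUP])
    show "incseq (\<lambda>n. integral\<^sup>N lborel (F n))"
      using F_inc by (auto simp: incseq_def le_fun_def intro!: nn_integral_mono)
    show "(\<lambda>n. integral\<^sup>N lborel (F n)) \<longlonglongrightarrow> ennreal (2 * pi * c)"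
      unfolding F_nn by (rule lim1)
  qed
  finally show ?thesis using c by (simp add: ennreal_mult)
qed

section \<open>The Fourier transform on L2\<close>

lemma integrable_cut:
  assumes "\<phi> \<in> L2R"
  shows "integrable lborel (cut n \<phi>)"
proof -
  have "(\<lambda>x. complex_of_real (indicator {- real n..real n} x)) \<in> L2R"
    by (rule L2R_bounded_support[where C=1 and R="real n"]) (auto simp: indicator_def)
  from integrable_mult_L2R[OF this assms] show ?thesis
    by (simp add: cut_def[abs_def] scaleR_conv_of_real)
qed

lemma is_L2_FT_iff:
  "is_L2_FT \<phi> g \<longleftrightarrow> g \<in> L2R \<and> (\<lambda>n. nsq (\<lambda>\<xi>. FT (cut n \<phi>) \<xi> - g \<xi>)) \<longlonglongrightarrow> 0"
  by (simp add: is_L2_FT_def trunc_FT_eq nsq_def)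

lemma Plancherel_diff:
  assumes "integrable lborel a" "a \<in> L2R" "integrable lborel b" "b \<in> L2R"
  shows "nsq (\<lambda>\<xi>. FT a \<xi> - FT b \<xi>) = ennreal (2 * pi) * nsq (\<lambda>x. a x - b x)"
proof -
  have "nsq (\<lambda>\<xi>. FT a \<xi> - FT b \<xi>) = nsq (FT (\<lambda>x. a x - b x))"
    using FT_diff[OF assms(1,3)] by (intro arg_cong[where f=nsq]) auto
  then show ?thesis using assms by (simp add: Plancherel L2R_diff)
qed

lemma L2R_FT: "integrable lborel a \<Longrightarrow> a \<in> L2R \<Longrightarrow> FT a \<in> L2R"
  by (simp add: L2R_iff Plancherel ennreal_mult_less_top)

lemma nsq_eq_integral:
  assumes "\<phi> \<in> L2R"
  shows "nsq \<phi> = ennreal (LINT x|lborel. (cmod (\<phi> x))\<^sup>2)"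
  unfolding nsq_def using assms by (intro nn_integral_eq_integral) (auto simp: L2R_def)

lemma L2R_cnj:
  assumes "\<phi> \<in> L2R"
  shows "(\<lambda>x. cnj (\<phi> x)) \<in> L2R"
proof -
  have [measurable]: "\<phi> \<in> borel_measurable borel" using assms by (simp add: L2R_iff)
  show ?thesis using assms by (simp add: L2R_iff nsq_def)
qed

lemma L2R_reflect:
  assumes "\<phi> \<in> L2R"
  shows "(\<lambda>x. \<phi> (- x)) \<in> L2R"
proof -
  have [measurable]: "\<phi> \<in> borel_measurable borel" using assms by (simp add: L2R_iff)
  show ?thesis using assms nsq_affine[of \<phi> "-1" 0] by (simp add: L2R_iff)
qed

lemma nsq_reflect: "\<phi> \<in> borel_measurable borel \<Longrightarrow> nsq (\<lambda>x. \<phi> (- x)) = nsq \<phi>"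
  using nsq_affine[of \<phi> "-1" 0] by simp

lemma integral_cmod_diff_sq:
  assumes \<phi>: "\<phi> \<in> L2R" and \<psi>: "\<psi> \<in> L2R"
  shows "(LINT x|lborel. (cmod (\<phi> x - \<psi> x))\<^sup>2) =
    (LINT x|lborel. (cmod (\<phi> x))\<^sup>2) + (LINT x|lborel. (cmod (\<psi> x))\<^sup>2) - 2 * Re (LINT x|lborel. \<phi> x * cnj (\<psi> x))"
proof -
  have sq: "(cmod (\<phi> x - \<psi> x))\<^sup>2 = (cmod (\<phi> x))\<^sup>2 + (cmod (\<psi> x))\<^sup>2 - 2 * Re (\<phi> x * cnj (\<psi> x))" for x
    unfolding cmod_power2 unfolding power2_eq_square by (simp add: algebra_simps)
  have I: "integrable lborel (\<lambda>x. \<phi> x * cnj (\<psi> x))"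
    by (intro integrable_mult_L2R \<phi> L2R_cnj \<psi>)
  have i: "integrable lborel (\<lambda>x. (cmod (\<phi> x))\<^sup>2)" "integrable lborel (\<lambda>x. (cmod (\<psi> x))\<^sup>2)"
    using \<phi> \<psi> by (auto simp: L2R_def)
  have "(LINT x|lborel. (cmod (\<phi> x - \<psi> x))\<^sup>2) =
      (LINT x|lborel. (cmod (\<phi> x))\<^sup>2 + (cmod (\<psi> x))\<^sup>2) - (LINT x|lborel. 2 * Re (\<phi> x * cnj (\<psi> x)))"
    unfolding sq using I i by (intro Bochner_Integration.integral_diff Bochner_Integration.integrable_add integrable_mult_right integrable_Re)
  also have "(LINT x|lborel. 2 * Re (\<phi> x * cnj (\<psi> x))) = 2 * Re (LINT x|lborel. \<phi> x * cnj (\<psi> x))"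
    using integral_Re[OF I] by (simp only: integral_mult_right_zero)
  also have "(LINT x|lborel. (cmod (\<phi> x))\<^sup>2 + (cmod (\<psi> x))\<^sup>2) = (LINT x|lborel. (cmod (\<phi> x))\<^sup>2) + (LINT x|lborel. (cmod (\<psi> x))\<^sup>2)"
    using i by (rule Bochner_Integration.integral_add)
  finally show ?thesis .
qed

lemma FT_cnj: "FT (\<lambda>x. cnj (b x)) \<xi> = cnj (FT b (- \<xi>))"
proof -
  have "FT (\<lambda>x. cnj (b x)) \<xi> = (LINT x|lborel. cnj (b x * cis (- x * (- \<xi>))))"
    unfolding FT_def by (simp add: cis_cnj)
  also have "\<dots> = cnj (FT b (- \<xi>))"
    unfolding FT_def by (rule Bochner_Integration.integral_cnj)
  finally show ?thesis .
qed

text \<open>The adjoint of the isometry \<open>FT / sqrt (2 * pi)\<close> is again an isometry, being its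
  composition with a reflection; hence the transform is onto.\<close>

lemma Plancherel_inverse:
  assumes a: "integrable lborel a" "a \<in> L2R" and b: "integrable lborel b" "b \<in> L2R"
  shows "nsq (\<lambda>\<xi>. FT a \<xi> - b \<xi>) = ennreal (2 * pi) * nsq (\<lambda>x. a x - complex_of_real (1 / (2 * pi)) * FT b (- x))"
proof -
  let ?r = "complex_of_real (1 / (2 * pi))"
  define b' where "b' x = ?r * FT b (- x)" for x
  have b': "b' \<in> L2R" unfolding b'_def by (intro L2R_cmult L2R_reflect L2R_FT b)
  have FTa: "FT a \<in> L2R" by (intro L2R_FT a)
  have Nb: "nsq b' = ennreal (1 / (2 * pi)) * nsq b"
  proof -
    have "nsq b' = ennreal ((1 / (2 * pi))\<^sup>2) * nsq (FT b)"
      unfolding b'_def using b by (subst nsq_cmult) (auto simp: nsq_reflect norm_divide L2R_iff)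
    also have "\<dots> = ennreal ((1 / (2 * pi))\<^sup>2 * (2 * pi)) * nsq b"
      by (simp add: Plancherel b ennreal_mult mult.assoc)
    also have "(1 / (2 * pi))\<^sup>2 * (2 * pi) = 1 / (2 * pi)" by (simp add: power2_eq_square)
    finally show ?thesis .
  qed
  have na: "(LINT x|lborel. (cmod (FT a x))\<^sup>2) = 2 * pi * (LINT x|lborel. (cmod (a x))\<^sup>2)"
    using Plancherel[OF a] unfolding nsq_eq_integral[OF FTa] nsq_eq_integral[OF a(2)]
    by (simp flip: ennreal_mult)
  have nb: "(LINT x|lborel. (cmod (b x))\<^sup>2) = 2 * pi * (LINT x|lborel. (cmod (b' x))\<^sup>2)"
    using Nb unfolding nsq_eq_integral[OF b'] nsq_eq_integral[OF b(2)]
    by (simp flip: ennreal_mult)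
  have "(LINT x|lborel. FT a x * cnj (b x)) = (LINT x|lborel. a x * FT (\<lambda>x. cnj (b x)) x)"
    using b by (intro FT_mult_formula a) auto
  also have "\<dots> = (LINT x|lborel. complex_of_real (2 * pi) * (a x * cnj (b' x)))"
    by (simp add: FT_cnj b'_def)
  also have "\<dots> = complex_of_real (2 * pi) * (LINT x|lborel. a x * cnj (b' x))"
    by (rule integral_mult_right_zero)
  finally have ab: "Re (LINT x|lborel. FT a x * cnj (b x)) = 2 * pi * Re (LINT x|lborel. a x * cnj (b' x))"
    by simp
  \<comment> \<open>Expanding the square leaves two norms and an inner product; each is 2 pi times
    its counterpart for \<open>a\<close> and \<open>b'\<close>, by Plancherel for \<open>a\<close>,
    by Plancherel for \<open>b\<close>, and by the multiplication formula.\<close>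
  have "(LINT x|lborel. (cmod (FT a x - b x))\<^sup>2) = 2 * pi * (LINT x|lborel. (cmod (a x - b' x))\<^sup>2)"
    unfolding integral_cmod_diff_sq[OF FTa b(2)] integral_cmod_diff_sq[OF a(2) b'] na nb ab
    by (simp add: algebra_simps)
  then show ?thesis
    using nsq_eq_integral[OF L2R_diff[OF FTa b(2)]] nsq_eq_integral[OF L2R_diff[OF a(2) b']]
    by (simp add: b'_def ennreal_mult)
qed

lemma tendsto_zero_cmult_ennreal:
  fixes f :: "nat \<Rightarrow> ennreal"
  shows "f \<longlonglongrightarrow> 0 \<Longrightarrow> (\<lambda>n. ennreal r * f n) \<longlonglongrightarrow> 0"
  using ennreal_tendsto_cmult[of "ennreal r" f 0] by simp

text \<open>By Plancherel, two integrable L2 sequences with the same L2 limit have transforms with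
  the same limit. Other sequences than truncations are needed since the convolution of a truncation
  is not the truncation of the convolution.\<close>

lemma is_L2_FT_approx:
  assumes \<psi>: "\<psi> \<in> L2R" and h: "h \<in> L2R"
    and \<psi>n: "\<And>n. integrable lborel (\<psi>' n)" "\<And>n. \<psi>' n \<in> L2R"
    and lim: "(\<lambda>n. nsq (\<lambda>x. \<psi>' n x - \<psi> x)) \<longlonglongrightarrow> 0" "(\<lambda>n. nsq (\<lambda>\<xi>. FT (\<psi>' n) \<xi> - h \<xi>)) \<longlonglongrightarrow> 0"
  shows "is_L2_FT \<psi> h"
  unfolding is_L2_FT_iff
proof
  have [measurable]: "\<psi> \<in> borel_measurable borel" "h \<in> borel_measurable borel" "\<psi>' n \<in> borel_measurable borel" for n
    using \<psi> h \<psi>n by (auto simp: L2R_iff)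
  have "(\<lambda>n. nsq (\<lambda>x. cut n \<psi> x - \<psi>' n x)) \<longlonglongrightarrow> 0"
  proof (rule tendsto_zero_sandwich_double[OF cut_tendsto[OF \<psi>] lim(1)])
    fix n
    have "nsq (\<lambda>x. cut n \<psi> x - \<psi>' n x) \<le> 2 * nsq (\<lambda>x. cut n \<psi> x - \<psi> x) + 2 * nsq (\<lambda>x. \<psi> x - \<psi>' n x)"
      by (rule nsq_diff_triangle) measurable
    then show "nsq (\<lambda>x. cut n \<psi> x - \<psi>' n x) \<le> 2 * nsq (\<lambda>x. cut n \<psi> x - \<psi> x) + 2 * nsq (\<lambda>x. \<psi>' n x - \<psi> x)"
      by (simp only: nsq_diff_commute[of \<psi>])
  qed
  then have "(\<lambda>n. ennreal (2 * pi) * nsq (\<lambda>x. cut n \<psi> x - \<psi>' n x)) \<longlonglongrightarrow> 0"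
    by (rule tendsto_zero_cmult_ennreal)
  then have "(\<lambda>n. nsq (\<lambda>\<xi>. FT (cut n \<psi>) \<xi> - FT (\<psi>' n) \<xi>)) \<longlonglongrightarrow> 0"
    by (simp add: Plancherel_diff integrable_cut L2R_cut \<psi> \<psi>n)
  then show "(\<lambda>n. nsq (\<lambda>\<xi>. FT (cut n \<psi>) \<xi> - h \<xi>)) \<longlonglongrightarrow> 0"
    using lim(2) by (rule tendsto_zero_sandwich_double) (rule nsq_diff_triangle; measurable)
qed (rule h)

lemma is_L2_FT_exists:
  assumes \<phi>: "\<phi> \<in> L2R"
  shows "\<exists>g. is_L2_FT \<phi> g"
proof -
  have [measurable]: "\<phi> \<in> borel_measurable borel" using \<phi> by (simp add: L2R_iff)
  have "\<exists>g \<in> L2R. (\<lambda>n. nsq (\<lambda>x. FT (cut n \<phi>) x - g x)) \<longlonglongrightarrow> 0"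
  proof (rule L2_complete)
    show "FT (cut n \<phi>) \<in> L2R" for n by (intro L2R_FT integrable_cut L2R_cut \<phi>)
    fix e :: real assume e: "e > 0"
    \<comment> \<open>Chosen so that 2 pi (2 d + 2 d) = e: the doubled triangle inequality, followed
      by Plancherel.\<close>
    define d where "d = e / (8 * pi)"
    have d: "d > 0" using e by (simp add: d_def)
    have "eventually (\<lambda>n. nsq (\<lambda>x. cut n \<phi> x - \<phi> x) < ennreal d) sequentially"
      using cut_tendsto[OF \<phi>] d by (intro order_tendstoD) auto
    then obtain N where N: "\<And>n. n \<ge> N \<Longrightarrow> nsq (\<lambda>x. cut n \<phi> x - \<phi> x) < ennreal d"
      by (auto simp: eventually_sequentially)
    show "\<exists>N. \<forall>m\<ge>N. \<forall>n\<ge>N. nsq (\<lambda>x. FT (cut m \<phi>) x - FT (cut n \<phi>) x) \<le> ennreal e"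
    proof (intro exI allI impI)
      fix m n assume mn: "m \<ge> N" "n \<ge> N"
      have "nsq (\<lambda>x. cut m \<phi> x - cut n \<phi> x) \<le> 2 * nsq (\<lambda>x. cut m \<phi> x - \<phi> x) + 2 * nsq (\<lambda>x. \<phi> x - cut n \<phi> x)"
        by (rule nsq_diff_triangle) measurable
      also have "\<dots> \<le> 2 * ennreal d + 2 * ennreal d"
        unfolding nsq_diff_commute[of \<phi>] using N[OF mn(1)] N[OF mn(2)] by (intro add_mono mult_left_mono) auto
      also have "\<dots> = ennreal (2 * d + 2 * d)" using d by (intro ennreal_double_add) auto
      finally have "ennreal (2 * pi) * nsq (\<lambda>x. cut m \<phi> x - cut n \<phi> x) \<le> ennreal (2 * pi) * ennreal (2 * d + 2 * d)"
        by (rule mult_left_mono) simp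
      also have "\<dots> = ennreal (2 * pi * (2 * d + 2 * d))" using d by (intro ennreal_mult[symmetric]) auto
      also have "2 * pi * (2 * d + 2 * d) = e" by (simp add: d_def)
      finally show "nsq (\<lambda>x. FT (cut m \<phi>) x - FT (cut n \<phi>) x) \<le> ennreal e"
        by (simp add: Plancherel_diff integrable_cut L2R_cut \<phi>)
    qed
  qed
  then show ?thesis by (auto simp: is_L2_FT_iff)
qed

text \<open>Fourier inversion: the preimage is the reflected transform of g divided by 2 pi.
  \<open>Plancherel_inverse\<close>, applied to the truncations of the preimage and of g, turns
  closeness on the t side into closeness of the transforms.\<close>

lemma is_L2_FT_surj:
  assumes g: "g \<in> L2R"
  shows "\<exists>\<phi> \<in> L2R. is_L2_FT \<phi> g"
proof -
  let ?r = "complex_of_real (1 / (2 * pi))"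
  obtain h where h: "h \<in> L2R" "(\<lambda>n. nsq (\<lambda>\<xi>. FT (cut n g) \<xi> - h \<xi>)) \<longlonglongrightarrow> 0"
    using is_L2_FT_exists[OF g] by (auto simp: is_L2_FT_iff)
  have [measurable]: "g \<in> borel_measurable borel" "h \<in> borel_measurable borel" using g h by (auto simp: L2R_iff)
  define \<phi> where "\<phi> x = ?r * h (- x)" for x
  have \<phi>: "\<phi> \<in> L2R" unfolding \<phi>_def by (intro L2R_cmult L2R_reflect h)
  have [measurable]: "\<phi> \<in> borel_measurable borel" using \<phi> by (auto simp: L2R_iff)
  have "nsq (\<lambda>x. \<phi> x - ?r * FT (cut n g) (- x)) = ennreal ((cmod ?r)\<^sup>2) * nsq (\<lambda>\<xi>. FT (cut n g) \<xi> - h \<xi>)" for n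
  proof -
    have "(\<lambda>x. \<phi> x - ?r * FT (cut n g) (- x)) = (\<lambda>x. ?r * (h (- x) - FT (cut n g) (- x)))"
      by (simp add: \<phi>_def right_diff_distrib)
    then have "nsq (\<lambda>x. \<phi> x - ?r * FT (cut n g) (- x)) = ennreal ((cmod ?r)\<^sup>2) * nsq (\<lambda>x. h (- x) - FT (cut n g) (- x))"
      by (simp only: nsq_cmult) (rule nsq_cmult, measurable)
    also have "nsq (\<lambda>x. h (- x) - FT (cut n g) (- x)) = nsq (\<lambda>x. h x - FT (cut n g) x)"
      by (rule nsq_reflect) measurable
    finally show ?thesis by (simp only: nsq_diff_commute[of h])
  qed
  then have 1: "(\<lambda>n. nsq (\<lambda>x. \<phi> x - ?r * FT (cut n g) (- x))) \<longlonglongrightarrow> 0"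
    using tendsto_zero_cmult_ennreal[OF h(2)] by simp
  have "(\<lambda>n. nsq (\<lambda>x. cut n \<phi> x - ?r * FT (cut n g) (- x))) \<longlonglongrightarrow> 0"
    by (rule tendsto_zero_sandwich_double[OF cut_tendsto[OF \<phi>] 1]) (rule nsq_diff_triangle; measurable)
  then have "(\<lambda>n. nsq (\<lambda>\<xi>. FT (cut n \<phi>) \<xi> - cut n g \<xi>)) \<longlonglongrightarrow> 0"
    unfolding Plancherel_inverse[OF integrable_cut[OF \<phi>] L2R_cut[OF \<phi>] integrable_cut[OF g] L2R_cut[OF g]]
    by (rule tendsto_zero_cmult_ennreal)
  then have "(\<lambda>n. nsq (\<lambda>\<xi>. FT (cut n \<phi>) \<xi> - g \<xi>)) \<longlonglongrightarrow> 0"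
    using cut_tendsto[OF g] by (rule tendsto_zero_sandwich_double) (rule nsq_diff_triangle; measurable)
  then show ?thesis using \<phi> g by (auto simp: is_L2_FT_iff)
qed

lemma cut_add: "cut n (\<lambda>x. \<phi> x + \<psi> x) = (\<lambda>x. cut n \<phi> x + cut n \<psi> x)"
  by (simp add: cut_def scaleR_add_right fun_eq_iff)

lemma cut_cmult: "cut n (\<lambda>x. a * \<phi> x) = (\<lambda>x. a * cut n \<phi> x)"
  by (simp add: cut_def fun_eq_iff)

lemma is_L2_FT_add:
  assumes "\<phi> \<in> L2R" "\<psi> \<in> L2R" "is_L2_FT \<phi> g" "is_L2_FT \<psi> h"
  shows "is_L2_FT (\<lambda>x. \<phi> x + \<psi> x) (\<lambda>\<xi>. g \<xi> + h \<xi>)"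
  unfolding is_L2_FT_iff
proof
  have gh: "g \<in> L2R" "h \<in> L2R" "(\<lambda>n. nsq (\<lambda>\<xi>. FT (cut n \<phi>) \<xi> - g \<xi>)) \<longlonglongrightarrow> 0" "(\<lambda>n. nsq (\<lambda>\<xi>. FT (cut n \<psi>) \<xi> - h \<xi>)) \<longlonglongrightarrow> 0"
    using assms by (auto simp: is_L2_FT_iff)
  have [measurable]: "g \<in> borel_measurable borel" "h \<in> borel_measurable borel"
    "\<phi> \<in> borel_measurable borel" "\<psi> \<in> borel_measurable borel"
    using assms gh by (auto simp: L2R_iff)
  show "(\<lambda>\<xi>. g \<xi> + h \<xi>) \<in> L2R" by (intro L2R_add gh)
  show "(\<lambda>n. nsq (\<lambda>\<xi>. FT (cut n (\<lambda>x. \<phi> x + \<psi> x)) \<xi> - (g \<xi> + h \<xi>))) \<longlonglongrightarrow> 0"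
  proof (rule tendsto_zero_sandwich_double[OF gh(3,4)])
    fix n
    have "(\<lambda>\<xi>. FT (cut n (\<lambda>x. \<phi> x + \<psi> x)) \<xi> - (g \<xi> + h \<xi>)) = (\<lambda>\<xi>. (FT (cut n \<phi>) \<xi> - g \<xi>) + (FT (cut n \<psi>) \<xi> - h \<xi>))"
      using assms by (simp add: cut_add FT_add integrable_cut fun_eq_iff)
    then show "nsq (\<lambda>\<xi>. FT (cut n (\<lambda>x. \<phi> x + \<psi> x)) \<xi> - (g \<xi> + h \<xi>))
        \<le> 2 * nsq (\<lambda>\<xi>. FT (cut n \<phi>) \<xi> - g \<xi>) + 2 * nsq (\<lambda>\<xi>. FT (cut n \<psi>) \<xi> - h \<xi>)"
      by (simp only:) (rule nsq_add_le; measurable)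
  qed
qed

lemma FT_cmult: "FT (\<lambda>x. a * \<phi> x) \<xi> = a * FT \<phi> \<xi>"
  unfolding FT_def mult.assoc by (rule integral_mult_right_zero)

lemma is_L2_FT_cmult:
  assumes "\<phi> \<in> L2R" "is_L2_FT \<phi> g"
  shows "is_L2_FT (\<lambda>x. a * \<phi> x) (\<lambda>\<xi>. a * g \<xi>)"
  unfolding is_L2_FT_iff
proof
  have g: "g \<in> L2R" "(\<lambda>n. nsq (\<lambda>\<xi>. FT (cut n \<phi>) \<xi> - g \<xi>)) \<longlonglongrightarrow> 0"
    using assms by (auto simp: is_L2_FT_iff)
  have [measurable]: "g \<in> borel_measurable borel" "\<phi> \<in> borel_measurable borel"
    using assms g by (auto simp: L2R_iff)
  show "(\<lambda>\<xi>. a * g \<xi>) \<in> L2R" by (intro L2R_cmult g)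
  have "nsq (\<lambda>\<xi>. FT (cut n (\<lambda>x. a * \<phi> x)) \<xi> - a * g \<xi>) = ennreal ((cmod a)\<^sup>2) * nsq (\<lambda>\<xi>. FT (cut n \<phi>) \<xi> - g \<xi>)" for n
    unfolding cut_cmult FT_cmult right_diff_distrib[symmetric] by (rule nsq_cmult) measurable
  then show "(\<lambda>n. nsq (\<lambda>\<xi>. FT (cut n (\<lambda>x. a * \<phi> x)) \<xi> - a * g \<xi>)) \<longlonglongrightarrow> 0"
    using tendsto_zero_cmult_ennreal[OF g(2)] by simp
qed

lemma is_L2_FT_diff:
  assumes "\<phi> \<in> L2R" "\<psi> \<in> L2R" "is_L2_FT \<phi> g" "is_L2_FT \<psi> h"
  shows "is_L2_FT (\<lambda>x. \<phi> x - \<psi> x) (\<lambda>\<xi>. g \<xi> - h \<xi>)"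
  using is_L2_FT_add[OF assms(1) L2R_cmult[OF assms(2), of "-1"] assms(3) is_L2_FT_cmult[OF assms(2,4), of "-1"]]
  by simp

text \<open>Combined with linearity, this gives both uniqueness of the transform up to null sets and
  its injectivity. From g = 0 to \<phi> = 0 it is Plancherel for \<open>cut n \<phi>\<close> in the
  limit.\<close>

lemma is_L2_FT_AE_zero_iff:
  assumes \<phi>: "\<phi> \<in> L2R" and FT: "is_L2_FT \<phi> g"
  shows "(AE x in lborel. \<phi> x = 0) \<longleftrightarrow> (AE \<xi> in lborel. g \<xi> = 0)"
proof -
  have g: "g \<in> L2R" "(\<lambda>n. nsq (\<lambda>\<xi>. FT (cut n \<phi>) \<xi> - g \<xi>)) \<longlonglongrightarrow> 0"
    using FT by (auto simp: is_L2_FT_iff)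
  have [measurable]: "g \<in> borel_measurable borel" "\<phi> \<in> borel_measurable borel"
    using \<phi> g by (auto simp: L2R_iff)
  have pi: "ennreal (2 * pi) \<noteq> 0" by simp
  show ?thesis
  proof
    assume z: "AE x in lborel. \<phi> x = 0"
    have "FT (cut n \<phi>) \<xi> = 0" for n \<xi>
    proof -
      have "FT (cut n \<phi>) \<xi> = (LINT x|(lborel :: real measure). (0 :: complex))"
        unfolding FT_def using z by (intro integral_cong_AE) (auto simp: cut_def)
      then show ?thesis by simp
    qed
    then have "(\<lambda>n::nat. nsq g) \<longlonglongrightarrow> 0" using g(2) by (simp add: nsq_minus)
    then have "nsq g = 0" by (simp add: LIMSEQ_const_iff)
    then show "AE \<xi> in lborel. g \<xi> = 0" by (simp add: nsq_eq_0_iff)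
  next
    assume z: "AE \<xi> in lborel. g \<xi> = 0"
    have "nsq (\<lambda>\<xi>. FT (cut n \<phi>) \<xi> - g \<xi>) = ennreal (2 * pi) * nsq (cut n \<phi>)" for n
    proof -
      have "nsq (\<lambda>\<xi>. FT (cut n \<phi>) \<xi> - g \<xi>) = nsq (FT (cut n \<phi>))"
        using z by (intro nsq_cong_AE) auto
      then show ?thesis by (simp add: Plancherel integrable_cut L2R_cut \<phi>)
    qed
    then have "(\<lambda>n. ennreal (2 * pi) * nsq (cut n \<phi>)) \<longlonglongrightarrow> 0" using g(2) by simp
    then have "(\<lambda>n. ennreal (1 / (2 * pi)) * (ennreal (2 * pi) * nsq (cut n \<phi>))) \<longlonglongrightarrow> 0"
      by (rule tendsto_zero_cmult_ennreal)
    then have 1: "(\<lambda>n. nsq (cut n \<phi>)) \<longlonglongrightarrow> 0"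
      by (simp flip: mult.assoc ennreal_mult)
    have "(\<lambda>n::nat. nsq \<phi>) \<longlonglongrightarrow> 0"
    proof (rule tendsto_zero_sandwich_double[OF cut_tendsto[OF \<phi>] 1])
      fix n
      have "nsq (\<lambda>x. cut n \<phi> x - (cut n \<phi> x - \<phi> x)) \<le> 2 * nsq (cut n \<phi>) + 2 * nsq (\<lambda>x. cut n \<phi> x - \<phi> x)"
        by (rule nsq_diff_le) measurable
      then show "nsq \<phi> \<le> 2 * nsq (\<lambda>x. cut n \<phi> x - \<phi> x) + 2 * nsq (cut n \<phi>)"
        by (simp add: add.commute)
    qed
    then have "nsq \<phi> = 0" by (simp add: LIMSEQ_const_iff)
    then show "AE x in lborel. \<phi> x = 0" by (simp add: nsq_eq_0_iff)
  qed
qed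

text \<open>The Sobolev hypotheses concern the two half-lines separately, whereas the equation
  decouples in their sum and difference.\<close>

lemma sobolev_H_add:
  assumes "\<phi> \<in> sobolev_H \<alpha>" "\<psi> \<in> sobolev_H \<alpha>"
  shows "(\<lambda>x. \<phi> x + \<psi> x) \<in> sobolev_H \<alpha>"
proof -
  obtain g h where g: "\<phi> \<in> L2R" "is_L2_FT \<phi> g" "integrable lborel (\<lambda>\<xi>. (cmod (g \<xi>))\<^sup>2 * (1 + \<xi>\<^sup>2) powr \<alpha>)"
    and h: "\<psi> \<in> L2R" "is_L2_FT \<psi> h" "integrable lborel (\<lambda>\<xi>. (cmod (h \<xi>))\<^sup>2 * (1 + \<xi>\<^sup>2) powr \<alpha>)"
    using assms by (auto simp: sobolev_H_def)
  have [measurable]: "g \<in> borel_measurable borel" "h \<in> borel_measurable borel"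
    using g h by (auto simp: is_L2_FT_def L2R_iff)
  have "integrable lborel (\<lambda>\<xi>. (cmod (g \<xi> + h \<xi>))\<^sup>2 * (1 + \<xi>\<^sup>2) powr \<alpha>)"
  proof (rule Bochner_Integration.integrable_bound)
    show "integrable lborel (\<lambda>\<xi>. 2 * ((cmod (g \<xi>))\<^sup>2 * (1 + \<xi>\<^sup>2) powr \<alpha>) + 2 * ((cmod (h \<xi>))\<^sup>2 * (1 + \<xi>\<^sup>2) powr \<alpha>))"
      by (intro Bochner_Integration.integrable_add integrable_mult_right g h)
    show "AE \<xi> in lborel. norm ((cmod (g \<xi> + h \<xi>))\<^sup>2 * (1 + \<xi>\<^sup>2) powr \<alpha>) \<le>
        norm (2 * ((cmod (g \<xi>))\<^sup>2 * (1 + \<xi>\<^sup>2) powr \<alpha>) + 2 * ((cmod (h \<xi>))\<^sup>2 * (1 + \<xi>\<^sup>2) powr \<alpha>))"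
    proof (rule AE_I2)
      fix \<xi> :: real
      have "(cmod (g \<xi> + h \<xi>))\<^sup>2 * (1 + \<xi>\<^sup>2) powr \<alpha> \<le> (2 * (cmod (g \<xi>))\<^sup>2 + 2 * (cmod (h \<xi>))\<^sup>2) * (1 + \<xi>\<^sup>2) powr \<alpha>"
        by (intro mult_right_mono cmod_add_sq_le) simp
      then show "norm ((cmod (g \<xi> + h \<xi>))\<^sup>2 * (1 + \<xi>\<^sup>2) powr \<alpha>) \<le>
        norm (2 * ((cmod (g \<xi>))\<^sup>2 * (1 + \<xi>\<^sup>2) powr \<alpha>) + 2 * ((cmod (h \<xi>))\<^sup>2 * (1 + \<xi>\<^sup>2) powr \<alpha>))"
        by (simp add: algebra_simps abs_of_nonneg)
    qed
  qed measurable
  then show ?thesis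
    using is_L2_FT_add[OF g(1) h(1) g(2) h(2)] L2R_add[OF g(1) h(1)] by (auto simp: sobolev_H_def)
qed

lemma sobolev_H_cmult:
  assumes "\<phi> \<in> sobolev_H \<alpha>"
  shows "(\<lambda>x. a * \<phi> x) \<in> sobolev_H \<alpha>"
proof -
  obtain g where g: "\<phi> \<in> L2R" "is_L2_FT \<phi> g" "integrable lborel (\<lambda>\<xi>. (cmod (g \<xi>))\<^sup>2 * (1 + \<xi>\<^sup>2) powr \<alpha>)"
    using assms by (auto simp: sobolev_H_def)
  have "integrable lborel (\<lambda>\<xi>. (cmod a)\<^sup>2 * ((cmod (g \<xi>))\<^sup>2 * (1 + \<xi>\<^sup>2) powr \<alpha>))"
    by (intro integrable_mult_right g)
  then have "integrable lborel (\<lambda>\<xi>. (cmod (a * g \<xi>))\<^sup>2 * (1 + \<xi>\<^sup>2) powr \<alpha>)"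
    by (simp add: norm_mult power_mult_distrib mult.assoc)
  then show ?thesis
    using is_L2_FT_cmult[OF g(1,2)] L2R_cmult[OF g(1)] by (auto simp: sobolev_H_def)
qed

lemma sobolev_H_diff:
  assumes "\<phi> \<in> sobolev_H \<alpha>" "\<psi> \<in> sobolev_H \<alpha>"
  shows "(\<lambda>x. \<phi> x - \<psi> x) \<in> sobolev_H \<alpha>"
  using sobolev_H_add[OF assms(1) sobolev_H_cmult[OF assms(2), of "-1"]] by simp

section \<open>Convolution operators on L2: injectivity, surjectivity, Sobolev data\<close>

context conv_kernel
begin

lemma L2R_multiplier_mult:
  assumes "g \<in> L2R"
  shows "(\<lambda>\<xi>. multiplier \<xi> * g \<xi>) \<in> L2R"
proof -
  have [measurable]: "g \<in> borel_measurable borel" using assms by (simp add: L2R_iff)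
  let ?C = "complex_of_real (LINT s|M. cmod (k s))"
  have "nsq (\<lambda>\<xi>. multiplier \<xi> * g \<xi>) \<le> nsq (\<lambda>\<xi>. ?C * g \<xi>)"
    using cmod_multiplier_le by (intro nsq_mono) (auto simp: norm_mult intro!: mult_right_mono order_trans[OF _ abs_ge_self])
  also have "\<dots> < \<infinity>" using L2R_cmult[OF assms] by (simp add: L2R_iff)
  finally show ?thesis by (simp add: L2R_iff)
qed

text \<open>\<open>FT_conv\<close> gives the formula for truncations. In the limit, Young's
  inequality controls the convolutions and the boundedness of the multiplier controls the
  transforms.\<close>

lemma is_L2_FT_conv:
  assumes \<phi>: "\<phi> \<in> L2R" and FT: "is_L2_FT \<phi> g"
  shows "is_L2_FT (conv \<phi>) (\<lambda>\<xi>. multiplier \<xi> * g \<xi>)"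
proof (rule is_L2_FT_approx[where \<psi>'="\<lambda>n. conv (cut n \<phi>)"])
  have g: "g \<in> L2R" "(\<lambda>n. nsq (\<lambda>\<xi>. FT (cut n \<phi>) \<xi> - g \<xi>)) \<longlonglongrightarrow> 0"
    using FT by (auto simp: is_L2_FT_iff)
  have [measurable]: "g \<in> borel_measurable borel" "\<phi> \<in> borel_measurable borel"
    using \<phi> g by (auto simp: L2R_iff)
  show "conv \<phi> \<in> L2R" by (rule L2R_conv[OF \<phi>])
  show "(\<lambda>\<xi>. multiplier \<xi> * g \<xi>) \<in> L2R" by (rule L2R_multiplier_mult[OF g(1)])
  show "integrable lborel (conv (cut n \<phi>))" for n by (intro conv_integrable integrable_cut \<phi>)
  show "conv (cut n \<phi>) \<in> L2R" for n by (intro L2R_conv L2R_cut \<phi>)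
  let ?K = "\<integral>\<^sup>+s. ennreal (cmod (k s)) \<partial>M"
  let ?C = "complex_of_real (LINT s|M. cmod (k s))"
  have K: "?K\<^sup>2 < top" using k_nn_integral_finite by (simp add: power_less_top_ennreal)
  have le: "nsq (\<lambda>x. conv (cut n \<phi>) x - conv \<phi> x) \<le> ?K\<^sup>2 * nsq (\<lambda>x. cut n \<phi> x - \<phi> x)" for n
  proof -
    have "nsq (\<lambda>x. conv (cut n \<phi>) x - conv \<phi> x) = nsq (conv (\<lambda>x. cut n \<phi> x - \<phi> x))"
      using conv_diff_AE[OF L2R_cut[OF \<phi>] \<phi>, of n] by (intro nsq_cong_AE) auto
    also have "\<dots> \<le> ?K\<^sup>2 * nsq (\<lambda>x. cut n \<phi> x - \<phi> x)"
      by (intro nsq_conv_le L2R_diff L2R_cut \<phi>)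
    finally show ?thesis .
  qed
  have lim: "(\<lambda>n. ?K\<^sup>2 * nsq (\<lambda>x. cut n \<phi> x - \<phi> x)) \<longlonglongrightarrow> 0"
    using ennreal_tendsto_cmult[OF K cut_tendsto[OF \<phi>]] by simp
  show "(\<lambda>n. nsq (\<lambda>x. conv (cut n \<phi>) x - conv \<phi> x)) \<longlonglongrightarrow> 0"
    by (rule tendsto_sandwich[OF _ _ tendsto_const lim]) (use le in auto)
  have le: "nsq (\<lambda>\<xi>. FT (conv (cut n \<phi>)) \<xi> - multiplier \<xi> * g \<xi>) \<le> ennreal ((cmod ?C)\<^sup>2) * nsq (\<lambda>\<xi>. FT (cut n \<phi>) \<xi> - g \<xi>)" for n
  proof -
    have "nsq (\<lambda>\<xi>. FT (conv (cut n \<phi>)) \<xi> - multiplier \<xi> * g \<xi>) = nsq (\<lambda>\<xi>. multiplier \<xi> * (FT (cut n \<phi>) \<xi> - g \<xi>))"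
      by (simp add: FT_conv integrable_cut \<phi> right_diff_distrib)
    also have "\<dots> \<le> nsq (\<lambda>\<xi>. ?C * (FT (cut n \<phi>) \<xi> - g \<xi>))"
      using cmod_multiplier_le by (intro nsq_mono) (auto simp: norm_mult intro!: mult_right_mono order_trans[OF _ abs_ge_self])
    also have "\<dots> = ennreal ((cmod ?C)\<^sup>2) * nsq (\<lambda>\<xi>. FT (cut n \<phi>) \<xi> - g \<xi>)"
      by (rule nsq_cmult) measurable
    finally show ?thesis .
  qed
  show "(\<lambda>n. nsq (\<lambda>\<xi>. FT (conv (cut n \<phi>)) \<xi> - multiplier \<xi> * g \<xi>)) \<longlonglongrightarrow> 0"
    by (rule tendsto_sandwich[OF _ _ tendsto_const tendsto_zero_cmult_ennreal[OF g(2), of "(cmod ?C)\<^sup>2"]]) (use le in auto)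
qed

lemma conv_injective_iff:
  "(\<forall>\<phi> \<in> L2R. (AE t in lborel. conv \<phi> t = 0) \<longrightarrow> (AE t in lborel. \<phi> t = 0))
    \<longleftrightarrow> (AE \<xi> in lborel. multiplier \<xi> \<noteq> 0)"
proof
  assume inj: "\<forall>\<phi> \<in> L2R. (AE t in lborel. conv \<phi> t = 0) \<longrightarrow> (AE t in lborel. \<phi> t = 0)"
  \<comment> \<open>The zero set may have infinite measure, so its indicator need not be in L2; the
    root of the normal density is positive everywhere and square integrable.\<close>
  define g where "g \<xi> = (if multiplier \<xi> = 0 then complex_of_real (sqrt (std_normal_density \<xi>)) else 0)" for \<xi>
  have [measurable]: "g \<in> borel_measurable borel" unfolding g_def by measurable
  have "nsq g \<le> (\<integral>\<^sup>+\<xi>. ennreal (std_normal_density \<xi>) \<partial>lborel)"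
    unfolding nsq_def g_def by (intro nn_integral_mono ennreal_leI) auto
  also have "\<dots> < \<infinity>" using integrable_std_normal_density by (simp add: integrable_iff_bounded)
  finally have g: "g \<in> L2R" by (simp add: L2R_iff)
  then obtain \<phi> where \<phi>: "\<phi> \<in> L2R" "is_L2_FT \<phi> g" using is_L2_FT_surj by blast
  have "AE \<xi> in lborel. multiplier \<xi> * g \<xi> = 0" by (simp add: g_def)
  then have "AE t in lborel. conv \<phi> t = 0"
    using is_L2_FT_AE_zero_iff[OF L2R_conv[OF \<phi>(1)] is_L2_FT_conv[OF \<phi>]] by simp
  then have "AE t in lborel. \<phi> t = 0" using inj \<phi> by simp
  then have "AE \<xi> in lborel. g \<xi> = 0" using is_L2_FT_AE_zero_iff[OF \<phi>] by simp
  then show "AE \<xi> in lborel. multiplier \<xi> \<noteq> 0"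
  proof eventually_elim
    case (elim \<xi>)
    then show ?case using normal_density_pos[of 1 0 \<xi>] by (auto simp: g_def split: if_splits)
  qed
next
  assume m: "AE \<xi> in lborel. multiplier \<xi> \<noteq> 0"
  show "\<forall>\<phi> \<in> L2R. (AE t in lborel. conv \<phi> t = 0) \<longrightarrow> (AE t in lborel. \<phi> t = 0)"
  proof (intro ballI impI)
    fix \<phi> assume \<phi>: "\<phi> \<in> L2R" and z: "AE t in lborel. conv \<phi> t = 0"
    obtain g where g: "is_L2_FT \<phi> g" using is_L2_FT_exists[OF \<phi>] by blast
    have "AE \<xi> in lborel. multiplier \<xi> * g \<xi> = 0"
      using z is_L2_FT_AE_zero_iff[OF L2R_conv[OF \<phi>] is_L2_FT_conv[OF \<phi> g]] by simp
    with m have "AE \<xi> in lborel. g \<xi> = 0" by eventually_elim simp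
    then show "AE t in lborel. \<phi> t = 0" using is_L2_FT_AE_zero_iff[OF \<phi> g] by simp
  qed
qed

lemma conv_solvable:
  assumes \<psi>: "\<psi> \<in> L2R" "is_L2_FT \<psi> h" and m: "\<And>\<xi>. multiplier \<xi> \<noteq> 0"
    and q: "(\<lambda>\<xi>. h \<xi> / multiplier \<xi>) \<in> L2R"
  shows "\<exists>\<phi> \<in> L2R. AE t in lborel. conv \<phi> t = \<psi> t"
proof -
  obtain \<phi> where \<phi>: "\<phi> \<in> L2R" "is_L2_FT \<phi> (\<lambda>\<xi>. h \<xi> / multiplier \<xi>)" using is_L2_FT_surj[OF q] by blast
  have "is_L2_FT (\<lambda>t. conv \<phi> t - \<psi> t) (\<lambda>\<xi>. multiplier \<xi> * (h \<xi> / multiplier \<xi>) - h \<xi>)"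
    by (intro is_L2_FT_diff L2R_conv is_L2_FT_conv \<phi> \<psi>)
  then have "AE t in lborel. conv \<phi> t - \<psi> t = 0"
    using m by (subst is_L2_FT_AE_zero_iff) (auto intro: L2R_diff L2R_conv \<phi> \<psi>)
  then show ?thesis using \<phi> by auto
qed

lemma INF_cmod_multiplier_pos_iff:
  "(INF \<xi>. cmod (multiplier \<xi>)) > 0 \<longleftrightarrow> (\<exists>e>0. \<forall>\<xi>. e \<le> cmod (multiplier \<xi>))"
proof
  assume "(INF \<xi>. cmod (multiplier \<xi>)) > 0"
  moreover have "(INF \<xi>. cmod (multiplier \<xi>)) \<le> cmod (multiplier \<xi>)" for \<xi>
    by (rule cINF_lower) (auto intro: bdd_belowI[of _ 0])
  ultimately show "\<exists>e>0. \<forall>\<xi>. e \<le> cmod (multiplier \<xi>)" by blast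
next
  assume "\<exists>e>0. \<forall>\<xi>. e \<le> cmod (multiplier \<xi>)"
  then obtain e where e: "e > 0" "\<And>\<xi>. e \<le> cmod (multiplier \<xi>)" by blast
  have "e \<le> (INF \<xi>. cmod (multiplier \<xi>))" by (rule cINF_greatest) (auto simp: e)
  with e(1) show "(INF \<xi>. cmod (multiplier \<xi>)) > 0" by simp
qed

text \<open>A lower bound on the multiplier makes division by it bounded on L2. Conversely,
  arbitrarily small values allow transforms whose quotient by the multiplier has infinite norm, even
  though the multiplier may vanish nowhere.\<close>

lemma conv_surjective_iff:
  "(\<forall>\<psi> \<in> L2R. \<exists>\<phi> \<in> L2R. AE t in lborel. conv \<phi> t = \<psi> t) \<longleftrightarrow> (INF \<xi>. cmod (multiplier \<xi>)) > 0"
  unfolding INF_cmod_multiplier_pos_iff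
proof
  assume "\<exists>e>0. \<forall>\<xi>. e \<le> cmod (multiplier \<xi>)"
  then obtain e where e: "e > 0" "\<And>\<xi>. e \<le> cmod (multiplier \<xi>)" by blast
  show "\<forall>\<psi> \<in> L2R. \<exists>\<phi> \<in> L2R. AE t in lborel. conv \<phi> t = \<psi> t"
  proof
    fix \<psi> assume \<psi>: "\<psi> \<in> L2R"
    obtain h where h: "is_L2_FT \<psi> h" using is_L2_FT_exists[OF \<psi>] by blast
    then have hL: "h \<in> L2R" by (simp add: is_L2_FT_iff)
    then have [measurable]: "h \<in> borel_measurable borel" by (simp add: L2R_iff)
    have "nsq (\<lambda>\<xi>. h \<xi> / multiplier \<xi>) \<le> nsq (\<lambda>\<xi>. complex_of_real (1 / e) * h \<xi>)"
    proof (rule nsq_mono)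
      fix \<xi>
      have "cmod (h \<xi>) / cmod (multiplier \<xi>) \<le> cmod (h \<xi>) / e"
        using e by (intro divide_left_mono) (auto intro: mult_pos_pos less_le_trans)
      then show "cmod (h \<xi> / multiplier \<xi>) \<le> cmod (complex_of_real (1 / e) * h \<xi>)"
        using e by (simp add: norm_mult norm_divide)
    qed
    also have "\<dots> < \<infinity>" using L2R_cmult[OF hL] unfolding L2R_iff by blast
    finally have "(\<lambda>\<xi>. h \<xi> / multiplier \<xi>) \<in> L2R" by (simp add: L2R_iff)
    moreover have "multiplier \<xi> \<noteq> 0" for \<xi> using e(2)[of \<xi>] e(1) by auto
    ultimately show "\<exists>\<phi> \<in> L2R. AE t in lborel. conv \<phi> t = \<psi> t"
      by (intro conv_solvable[OF \<psi> h])
  qed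
next
  assume surj: "\<forall>\<psi> \<in> L2R. \<exists>\<phi> \<in> L2R. AE t in lborel. conv \<phi> t = \<psi> t"
  show "\<exists>e>0. \<forall>\<xi>. e \<le> cmod (multiplier \<xi>)"
  proof (rule ccontr)
    assume "\<not> (\<exists>e>0. \<forall>\<xi>. e \<le> cmod (multiplier \<xi>))"
    then have small: "\<exists>\<xi>. cmod (multiplier \<xi>) < e" if "e > 0" for e using that by (meson not_le)
    \<comment> \<open>Continuity around a point where the multiplier is below 2^(-n); halving the
      radius puts a closed interval inside the open neighbourhood. Intervals for different n may
      overlap.\<close>
    have "\<exists>a d. d > 0 \<and> (\<forall>y\<in>{a-d..a+d}. cmod (multiplier y) < (1/2)^n)" for n :: nat
    proof -
      obtain a where a: "cmod (multiplier a) < (1/2)^n" using small[of "(1/2)^n"] by auto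
      have "isCont (\<lambda>y. cmod (multiplier y)) a" by (intro continuous_intros isCont_multiplier)
      then have "eventually (\<lambda>y. cmod (multiplier y) < (1/2)^n) (nhds a)"
        using a tendsto_at_iff_tendsto_nhds[of "\<lambda>y. cmod (multiplier y)" a] by (intro order_tendstoD) (auto simp: isCont_def)
      then obtain d where d: "d > 0" "\<And>y. dist y a < d \<Longrightarrow> cmod (multiplier y) < (1/2)^n"
        by (auto simp: eventually_nhds_metric)
      show ?thesis
        using d by (intro exI[of _ a] exI[of _ "d/2"]) (auto simp: dist_real_def abs_if intro!: d(2))
    qed
    then obtain a d where d: "\<And>n. d n > 0"
      and ad: "\<And>n y. y \<in> {a n - d n..a n + d n} \<Longrightarrow> cmod (multiplier y) < (1/2)^n"
      by metis
    define A where "A n = {a n - d n..a n + d n}" for n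
    have [measurable]: "A n \<in> sets borel" for n by (simp add: A_def)
    have emA: "emeasure lborel (A n) = ennreal (2 * d n)" for n
      using d[of n] by (simp add: A_def)
    \<comment> \<open>\<open>h\<close> is square integrable, but \<open>h / multiplier\<close> has squared norm at least \<open>2^n\<close> on each \<open>A n\<close>.\<close>
    define H where "H y = (\<Sum>n. ennreal ((1/2)^n / (2 * d n)) * indicator (A n) y)" for y
    have [measurable]: "H \<in> borel_measurable borel" unfolding H_def by measurable
    have "(\<integral>\<^sup>+y. H y \<partial>lborel) = (\<Sum>n. ennreal ((1/2)^n / (2 * d n)) * emeasure lborel (A n))"
      unfolding H_def by (subst nn_integral_suminf) (auto simp: nn_integral_cmult_indicator)
    also have "\<dots> = (\<Sum>n. ennreal ((1/2)^n))"
    proof (rule suminf_cong)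
      fix n
      have "ennreal ((1/2)^n / (2 * d n)) * emeasure lborel (A n) = ennreal ((1/2)^n / (2 * d n) * (2 * d n))"
        unfolding emA using d[of n] by (intro ennreal_mult[symmetric]) auto
      then show "ennreal ((1/2)^n / (2 * d n)) * emeasure lborel (A n) = ennreal ((1/2)^n)"
        using d[of n] by simp
    qed
    also have "\<dots> = ennreal (\<Sum>n. (1/2)^n)" by (rule suminf_ennreal2) (auto intro: summable_geometric)
    finally have Hint: "(\<integral>\<^sup>+y. H y \<partial>lborel) < \<infinity>" by simp
    then have Hfin: "AE y in lborel. H y \<noteq> \<infinity>" by (intro nn_integral_PInf_AE) auto
    define h where "h y = complex_of_real (sqrt (enn2real (H y)))" for y
    have [measurable]: "h \<in> borel_measurable borel" unfolding h_def by measurable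
    \<comment> \<open>\<open>enn2real\<close> sends infinity to 0, so the identity holds only off
      the null set where \<open>H\<close> is infinite.\<close>
    have h_sq: "ennreal ((cmod (h y))\<^sup>2) = H y" if "H y \<noteq> \<infinity>" for y
      using that by (simp add: h_def ennreal_enn2real_if)
    have "nsq h = (\<integral>\<^sup>+y. H y \<partial>lborel)"
      unfolding nsq_def using Hfin by (intro nn_integral_cong_AE, eventually_elim) (rule h_sq)
    then have hL: "h \<in> L2R" using Hint by (simp add: L2R_iff)
    obtain \<psi> where \<psi>: "\<psi> \<in> L2R" "is_L2_FT \<psi> h" using is_L2_FT_surj[OF hL] by blast
    obtain \<phi> where \<phi>: "\<phi> \<in> L2R" "AE t in lborel. conv \<phi> t = \<psi> t" using surj \<psi> by blast
    obtain g where g: "is_L2_FT \<phi> g" using is_L2_FT_exists[OF \<phi>(1)] by blast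
    have gL: "g \<in> L2R" using g by (simp add: is_L2_FT_iff)
    then have [measurable]: "g \<in> borel_measurable borel" by (simp add: L2R_iff)
    have "is_L2_FT (\<lambda>t. conv \<phi> t - \<psi> t) (\<lambda>\<xi>. multiplier \<xi> * g \<xi> - h \<xi>)"
      by (intro is_L2_FT_diff L2R_conv is_L2_FT_conv \<phi> \<psi> g)
    moreover have "AE t in lborel. conv \<phi> t - \<psi> t = 0" using \<phi>(2) by auto
    ultimately have "AE \<xi> in lborel. multiplier \<xi> * g \<xi> - h \<xi> = 0"
      using is_L2_FT_AE_zero_iff[OF L2R_diff[OF L2R_conv[OF \<phi>(1)] \<psi>(1)]] by blast
    then have eq: "AE \<xi> in lborel. multiplier \<xi> * g \<xi> = h \<xi>" by simp
    have big: "ennreal (2^n) \<le> nsq g" for n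
    proof -
      have "ennreal (2^n) = ennreal (2^n / (2 * d n)) * emeasure lborel (A n)"
        unfolding emA using d[of n] by (subst ennreal_mult[symmetric]) auto
      also have "\<dots> = (\<integral>\<^sup>+y. ennreal (2^n / (2 * d n)) * indicator (A n) y \<partial>lborel)"
        by (simp add: nn_integral_cmult_indicator)
      also have "\<dots> \<le> nsq g"
        unfolding nsq_def
      proof (rule nn_integral_mono_AE, use eq Hfin in eventually_elim)
        case (elim y)
        show "ennreal (2^n / (2 * d n)) * indicator (A n) y \<le> ennreal ((cmod (g y))\<^sup>2)"
        proof (cases "y \<in> A n")
          case True
          \<comment> \<open>A single term of the nonnegative series already gives the bound, so the
            overlaps do no harm. The factor 4^n below cancels the squared bound on the
            multiplier.\<close>
          have "(\<Sum>i\<in>{n}. ennreal ((1/2)^i / (2 * d i)) * indicator (A i) y) \<le> H y"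
            unfolding H_def by (rule sum_le_suminf) auto
          then have "ennreal ((1/2)^n / (2 * d n)) \<le> ennreal ((cmod (h y))\<^sup>2)"
            using True h_sq[OF elim(2)] by simp
          then have "(1/2)^n / (2 * d n) \<le> (cmod (h y))\<^sup>2" by (auto simp: ennreal_le_iff2)
          also have "(cmod (h y))\<^sup>2 = (cmod (multiplier y))\<^sup>2 * (cmod (g y))\<^sup>2"
            by (simp add: elim(1)[symmetric] norm_mult power_mult_distrib)
          also have "\<dots> \<le> ((1/2)^n)\<^sup>2 * (cmod (g y))\<^sup>2"
            using ad[of y n] True by (intro mult_right_mono power_mono) (auto simp: A_def)
          finally have "2^n * 2^n * ((1/2)^n / (2 * d n)) \<le> 2^n * 2^n * (((1/2)^n)\<^sup>2 * (cmod (g y))\<^sup>2)"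
            by (intro mult_left_mono) auto
          also have "\<dots> = (cmod (g y))\<^sup>2"
            by (simp add: power2_eq_square power_one_over)
          also have "2^n * 2^n * ((1/2)^n / (2 * d n)) = 2^n / (2 * d n)"
            by (simp add: power_one_over)
          finally show ?thesis using True by (simp add: ennreal_leI)
        qed simp
      qed
      finally show ?thesis .
    qed
    obtain r where r: "r \<ge> 0" "nsq g = ennreal r"
      using gL by (auto simp: L2R_iff less_top elim: ennreal_cases)
    obtain n where "r < 2^n" using real_arch_pow[of 2 r] by auto
    with big[of n] r show False by (simp add: ennreal_le_iff2)
  qed
qed

text \<open>The reciprocal of the multiplier is at most 2 (1 + \<xi>^2)^(\<alpha>/2) / \<gamma>; its
  square is 4 / \<gamma>^2 times the Sobolev weight, so the quotient by the multiplier is still in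
  L2.\<close>

lemma conv_solvable_sobolev:
  assumes \<alpha>: "\<alpha> \<ge> 0" and \<gamma>: "\<gamma> > 0"
    and m: "\<And>\<xi>. cmod (multiplier \<xi>) \<ge> \<gamma> / (1 + rpow \<bar>\<xi>\<bar> \<alpha>)"
    and \<psi>: "\<psi> \<in> sobolev_H \<alpha>"
  shows "\<exists>\<phi> \<in> L2R. AE t in lborel. conv \<phi> t = \<psi> t"
proof -
  obtain h where h: "\<psi> \<in> L2R" "is_L2_FT \<psi> h" "integrable lborel (\<lambda>\<xi>. (cmod (h \<xi>))\<^sup>2 * (1 + \<xi>\<^sup>2) powr \<alpha>)"
    using \<psi> by (auto simp: sobolev_H_def)
  have [measurable]: "h \<in> borel_measurable borel" using h by (auto simp: is_L2_FT_iff L2R_iff)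
  have rp: "0 \<le> rpow \<bar>\<xi>\<bar> \<alpha>" for \<xi> by (simp add: rpow_def)
  have mpos: "cmod (multiplier \<xi>) > 0" for \<xi>
  proof -
    have "0 < \<gamma> / (1 + rpow \<bar>\<xi>\<bar> \<alpha>)" using \<gamma> rp[of \<xi>] by (intro divide_pos_pos) auto
    then show ?thesis using m[of \<xi>] by (rule less_le_trans)
  qed
  have key: "(cmod (h \<xi> / multiplier \<xi>))\<^sup>2 \<le> (4 / \<gamma>\<^sup>2) * ((cmod (h \<xi>))\<^sup>2 * (1 + \<xi>\<^sup>2) powr \<alpha>)" for \<xi>
  proof -
    \<comment> \<open>The origin is treated apart because of the convention 0^0 = 1 built into
      \<open>rpow\<close>; there the right-hand side is 1.\<close>
    have r1: "rpow \<bar>\<xi>\<bar> \<alpha> \<le> (1 + \<xi>\<^sup>2) powr (\<alpha> / 2)"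
    proof (cases "\<xi> = 0")
      case True
      then show ?thesis by (simp add: rpow_def)
    next
      case False
      have "\<bar>\<xi>\<bar> powr 2 = \<xi>\<^sup>2" using False by simp
      then have "\<bar>\<xi>\<bar> powr \<alpha> = (\<xi>\<^sup>2) powr (\<alpha> / 2)"
        using powr_powr[of "\<bar>\<xi>\<bar>" 2 "\<alpha> / 2"] by simp
      also have "\<dots> \<le> (1 + \<xi>\<^sup>2) powr (\<alpha> / 2)" using \<alpha> by (intro powr_mono2) auto
      finally show ?thesis using False by (simp add: rpow_def)
    qed
    have "1 \<le> (1 + \<xi>\<^sup>2) powr (\<alpha> / 2)" using \<alpha> by (intro ge_one_powr_ge_zero) auto
    with r1 have r2: "1 + rpow \<bar>\<xi>\<bar> \<alpha> \<le> 2 * (1 + \<xi>\<^sup>2) powr (\<alpha> / 2)" by simp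
    have "1 / cmod (multiplier \<xi>) \<le> (1 + rpow \<bar>\<xi>\<bar> \<alpha>) / \<gamma>"
      using m[of \<xi>] mpos[of \<xi>] \<gamma> rp[of \<xi>] by (simp add: field_simps add_pos_nonneg)
    also have "\<dots> \<le> 2 * (1 + \<xi>\<^sup>2) powr (\<alpha> / 2) / \<gamma>" using r2 \<gamma> by (simp add: divide_right_mono)
    finally have "(1 / cmod (multiplier \<xi>))\<^sup>2 \<le> (2 * (1 + \<xi>\<^sup>2) powr (\<alpha> / 2) / \<gamma>)\<^sup>2"
      using mpos[of \<xi>] by (intro power_mono) auto
    also have "\<dots> = (4 / \<gamma>\<^sup>2) * ((1 + \<xi>\<^sup>2) powr (\<alpha> / 2))\<^sup>2"
      by (simp add: power_divide power_mult_distrib)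
    also have "((1 + \<xi>\<^sup>2) powr (\<alpha> / 2))\<^sup>2 = (1 + \<xi>\<^sup>2) powr \<alpha>"
      unfolding power2_eq_square[of "(1 + \<xi>\<^sup>2) powr (\<alpha> / 2)"] powr_add[symmetric] by simp
    finally have "(cmod (h \<xi>))\<^sup>2 * (1 / cmod (multiplier \<xi>))\<^sup>2 \<le> (cmod (h \<xi>))\<^sup>2 * ((4 / \<gamma>\<^sup>2) * (1 + \<xi>\<^sup>2) powr \<alpha>)"
      by (rule mult_left_mono) simp
    then show ?thesis by (simp add: norm_divide power_divide mult_ac)
  qed
  have "integrable lborel (\<lambda>\<xi>. (cmod (h \<xi> / multiplier \<xi>))\<^sup>2)"
    by (rule Bochner_Integration.integrable_bound[OF integrable_mult_right[OF h(3), of "4 / \<gamma>\<^sup>2"]])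
       (use key in \<open>auto intro!: order_trans[OF _ abs_ge_self]\<close>)
  then have "(\<lambda>\<xi>. h \<xi> / multiplier \<xi>) \<in> L2R" by (simp add: L2R_def)
  moreover have "multiplier \<xi> \<noteq> 0" for \<xi> using mpos[of \<xi>] by auto
  ultimately show ?thesis by (intro conv_solvable[OF h(1,2)])
qed

end

section \<open>Logarithmic coordinates\<close>

text \<open>Substitution on the compact intervals [-(n+1), n+1], followed by monotone convergence on
  both sides.\<close>

lemma nn_integral_exp_substitution:
  fixes h :: "real \<Rightarrow> ennreal"
  assumes [measurable]: "h \<in> borel_measurable borel"
  shows "(\<integral>\<^sup>+t. h (exp t) * ennreal (exp t) \<partial>lborel) = (\<integral>\<^sup>+x. h x * indicator {0<..} x \<partial>lborel)"
proof -
  define a where "a n = - real (Suc n)" for n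
  define b where "b n = real (Suc n)" for n
  have step: "(\<integral>\<^sup>+x. h x * indicator {exp (a n)..exp (b n)} x \<partial>lborel) =
      (\<integral>\<^sup>+t. h (exp t) * ennreal (exp t) * indicator {a n..b n} t \<partial>lborel)" for n
    by (rule nn_integral_substitution_aux) (auto simp: a_def b_def intro!: derivative_eq_intros continuous_intros)
  have ab: "a (Suc n) \<le> a n" "b n \<le> b (Suc n)" for n by (auto simp: a_def b_def)
  have R: "(\<integral>\<^sup>+t. h (exp t) * ennreal (exp t) \<partial>lborel) = (SUP n. \<integral>\<^sup>+t. h (exp t) * ennreal (exp t) * indicator {a n..b n} t \<partial>lborel)"
  proof -
    have "(SUP n. h (exp t) * ennreal (exp t) * indicator {a n..b n} t) = h (exp t) * ennreal (exp t)" for t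
    proof (rule antisym)
      show "(SUP n. h (exp t) * ennreal (exp t) * indicator {a n..b n} t) \<le> h (exp t) * ennreal (exp t)"
        by (intro SUP_least) (auto simp: indicator_def)
      obtain n where "real n \<ge> \<bar>t\<bar>" using real_arch_simple by blast
      then have "t \<in> {a n..b n}" by (auto simp: a_def b_def)
      then show "h (exp t) * ennreal (exp t) \<le> (SUP n. h (exp t) * ennreal (exp t) * indicator {a n..b n} t)"
        by (intro SUP_upper2[of n]) auto
    qed
    then have "(\<integral>\<^sup>+t. h (exp t) * ennreal (exp t) \<partial>lborel) = (\<integral>\<^sup>+t. (SUP n. h (exp t) * ennreal (exp t) * indicator {a n..b n} t) \<partial>lborel)"
      by simp
    also have "\<dots> = (SUP n. \<integral>\<^sup>+t. h (exp t) * ennreal (exp t) * indicator {a n..b n} t \<partial>lborel)"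
    proof (rule nn_integral_monotone_convergence_SUP)
      show "incseq (\<lambda>n t. h (exp t) * ennreal (exp t) * indicator {a n..b n} t)"
        using ab by (intro incseq_SucI le_funI mult_left_mono) (auto simp: indicator_def intro: order_trans)
    qed measurable
    finally show ?thesis .
  qed
  have L: "(\<integral>\<^sup>+x. h x * indicator {0<..} x \<partial>lborel) = (SUP n. \<integral>\<^sup>+x. h x * indicator {exp (a n)..exp (b n)} x \<partial>lborel)"
  proof -
    have "(SUP n. h x * indicator {exp (a n)..exp (b n)} x) = h x * indicator {0<..} x" for x
    proof (cases "x > 0")
      case True
      show ?thesis
      proof (rule antisym)
        show "(SUP n. h x * indicator {exp (a n)..exp (b n)} x) \<le> h x * indicator {0<..} x"
          using True by (intro SUP_least) (auto simp: indicator_def)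
        obtain n where "real n \<ge> \<bar>ln x\<bar>" using real_arch_simple by blast
        then have "a n \<le> ln x" "ln x \<le> b n" by (auto simp: a_def b_def)
        then have "exp (a n) \<le> exp (ln x)" "exp (ln x) \<le> exp (b n)" by (auto simp only: exp_le_cancel_iff)
        then have "x \<in> {exp (a n)..exp (b n)}" using True by simp
        then show "h x * indicator {0<..} x \<le> (SUP n. h x * indicator {exp (a n)..exp (b n)} x)"
          using True by (intro SUP_upper2[of n]) auto
      qed
    next
      case False
      then have "x \<notin> {exp (a n)..exp (b n)}" for n using exp_gt_zero[of "a n"] by (auto simp del: exp_gt_zero)
      then show ?thesis using False by simp
    qed
    then have "(\<integral>\<^sup>+x. h x * indicator {0<..} x \<partial>lborel) = (\<integral>\<^sup>+x. (SUP n. h x * indicator {exp (a n)..exp (b n)} x) \<partial>lborel)"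
      by simp
    also have "\<dots> = (SUP n. \<integral>\<^sup>+x. h x * indicator {exp (a n)..exp (b n)} x \<partial>lborel)"
    proof (rule nn_integral_monotone_convergence_SUP)
      have e: "exp (a (Suc n)) \<le> exp (a n)" "exp (b n) \<le> exp (b (Suc n))" for n using ab by auto
      show "incseq (\<lambda>n x. h x * indicator {exp (a n)..exp (b n)} x)"
        by (intro incseq_SucI le_funI mult_left_mono)
           (auto simp: indicator_def intro: order_trans[OF e(1)] order_trans[OF _ e(2)])
    qed measurable
    finally show ?thesis .
  qed
  show ?thesis unfolding R L step ..
qed

text \<open>\<open>P\<close> is arbitrary, so the argument runs through a measurable null set
  containing the exceptions. As the density e^t is positive, the substitution formula for its
  indicator preserves nullity in both directions.\<close>

lemma AE_lborel_exp_iff: "(AE t in lborel. P (exp t)) \<longleftrightarrow> (AE x in lborel. x > 0 \<longrightarrow> P (x :: real))"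
proof
  assume "AE t in lborel. P (exp t)"
  then obtain N where N: "{t. \<not> P (exp t)} \<subseteq> N" "N \<in> null_sets lborel"
    by (auto simp: eventually_ae_filter)
  have [measurable]: "N \<in> sets borel" using N(2) by auto
  have "AE t in lborel. t \<notin> N" using N(2) by (rule AE_not_in)
  then have "AE t in lborel. indicator N (ln (exp t)) * ennreal (exp t) = 0"
    by eventually_elim simp
  then have "(\<integral>\<^sup>+t. indicator N (ln (exp t)) * ennreal (exp t) \<partial>lborel) = 0"
    by (subst nn_integral_0_iff_AE; measurable)
  then have "(\<integral>\<^sup>+x. indicator N (ln x) * indicator {0<..} x \<partial>lborel) = 0"
    using nn_integral_exp_substitution[of "\<lambda>x. indicator N (ln x)"] by simp
  then have "AE x in lborel. indicator N (ln x) * indicator {0<..} x = (0 :: ennreal)"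
    by (subst (asm) nn_integral_0_iff_AE; measurable)
  then show "AE x in lborel. x > 0 \<longrightarrow> P x"
  proof eventually_elim
    case (elim x)
    show ?case
    proof
      assume "x > 0"
      then have "ln x \<notin> N" using elim by (auto simp: indicator_def split: if_splits)
      then have "P (exp (ln x))" using N(1) by blast
      then show "P x" using \<open>x > 0\<close> by simp
    qed
  qed
next
  assume "AE x in lborel. x > 0 \<longrightarrow> P x"
  then obtain N where N: "{x. \<not> (x > 0 \<longrightarrow> P x)} \<subseteq> N" "N \<in> null_sets lborel"
    by (auto simp: eventually_ae_filter)
  have [measurable]: "N \<in> sets borel" using N(2) by auto
  have "AE x in lborel. x \<notin> N" using N(2) by (rule AE_not_in)
  then have "AE x in lborel. indicator N x * indicator {0<..} x = (0 :: ennreal)"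
    by eventually_elim simp
  then have "(\<integral>\<^sup>+x. indicator N x * indicator {0<..} x \<partial>lborel) = 0"
    by (subst nn_integral_0_iff_AE; measurable)
  then have "(\<integral>\<^sup>+t. indicator N (exp t) * ennreal (exp t) \<partial>lborel) = 0"
    using nn_integral_exp_substitution[of "indicator N"] by simp
  then have "AE t in lborel. indicator N (exp t) * ennreal (exp t) = 0"
    by (subst (asm) nn_integral_0_iff_AE; measurable)
  then show "AE t in lborel. P (exp t)"
  proof eventually_elim
    case (elim t)
    then have "exp t \<notin> N" by (auto simp: indicator_def split: if_splits)
    then show ?case using N(1) exp_gt_zero[of t] by blast
  qed
qed

lemma AE_lborel_uminus_iff: "(AE x in lborel. P (- x)) \<longleftrightarrow> (AE x in lborel. P (x :: real))"
proof -
  have *: "AE x in lborel. Q (- x)" if "AE x in lborel. Q x" for Q :: "real \<Rightarrow> bool"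
  proof -
    from that obtain N where N: "{x. \<not> Q x} \<subseteq> N" "N \<in> null_sets lborel"
      by (auto simp: eventually_ae_filter)
    have [measurable]: "N \<in> sets borel" using N(2) by auto
    have "(\<integral>\<^sup>+x. indicator N (0 + - 1 * x) \<partial>lborel) = (\<integral>\<^sup>+x. indicator N x \<partial>lborel)"
      by (subst nn_integral_real_affine[of "indicator N" "-1" 0]) auto
    also have "\<dots> = 0" using N(2) by (auto simp: nn_integral_indicator)
    finally have "(\<integral>\<^sup>+x. indicator N (- x) \<partial>lborel) = 0" by simp
    then have "AE x in lborel. indicator N (- x) = (0 :: ennreal)"
      by (subst (asm) nn_integral_0_iff_AE; measurable)
    then show ?thesis
      by eventually_elim (use N(1) in \<open>auto simp: indicator_def split: if_splits\<close>)
  qed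
  show ?thesis using *[of P] *[of "\<lambda>x. P (- x)"] by (intro iffI) simp_all
qed

lemma AE_lborel_exp_split:
  "(AE x in lborel. x \<noteq> 0 \<longrightarrow> P (x :: real)) \<longleftrightarrow> (AE t in lborel. P (exp t) \<and> P (- exp t))"
proof -
  have "(AE x in lborel. x \<noteq> 0 \<longrightarrow> P x) \<longleftrightarrow> (AE x in lborel. (x > 0 \<longrightarrow> P x) \<and> (x < 0 \<longrightarrow> P x))"
    by (intro AE_cong) auto
  also have "\<dots> \<longleftrightarrow> (AE x in lborel. x > 0 \<longrightarrow> P x) \<and> (AE x in lborel. x < 0 \<longrightarrow> P x)"
    by (rule AE_conj_iff)
  also have "(AE x in lborel. x < 0 \<longrightarrow> P x) \<longleftrightarrow> (AE x in lborel. x > 0 \<longrightarrow> P (- x))"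
    using AE_lborel_uminus_iff[of "\<lambda>x. x < 0 \<longrightarrow> P x"] by simp
  also have "(AE x in lborel. x > 0 \<longrightarrow> P x) \<and> (AE x in lborel. x > 0 \<longrightarrow> P (- x)) \<longleftrightarrow>
      (AE t in lborel. P (exp t)) \<and> (AE t in lborel. P (- exp t))"
    using AE_lborel_exp_iff[of P] AE_lborel_exp_iff[of "\<lambda>x. P (- x)"] by simp
  finally show ?thesis by (simp add: AE_conj_iff)
qed

lemma AE_nonzero: "(AE x in lborel. x \<noteq> 0 \<longrightarrow> P x) \<longleftrightarrow> (AE x in lborel. P (x :: real))"
proof
  assume "AE x in lborel. x \<noteq> 0 \<longrightarrow> P x"
  moreover have "AE x in lborel. x \<noteq> (0 :: real)" by (rule AE_lborel_singleton)
  ultimately show "AE x in lborel. P x" by eventually_elim simp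
qed auto

text \<open>Twice the even part of \<open>Mop c w\<close>, read at e^t; \<open>odd_log\<close> is
  the odd counterpart. The omitted factor 1/2 reappears in
  \<open>kernel_log_coordinates\<close>.\<close>

definition even_log :: "real \<Rightarrow> (real \<Rightarrow> complex) \<Rightarrow> real \<Rightarrow> complex" where
  "even_log c w t = Mop c w (exp t) + Mop c w (- exp t)"

definition odd_log :: "real \<Rightarrow> (real \<Rightarrow> complex) \<Rightarrow> real \<Rightarrow> complex" where
  "odd_log c w t = Mop c w (exp t) - Mop c w (- exp t)"

lemma Mop_exp_cancel: "Mop c v (exp t) = Mop c w (exp t) \<longleftrightarrow> v (exp t) = w (exp t)"
  "Mop c v (- exp t) = Mop c w (- exp t) \<longleftrightarrow> v (- exp t) = w (- exp t)"
  by (simp_all add: Mop_def)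

lemma AE_eq_iff_even_odd_log:
  "(AE x in lborel. v x = w x) \<longleftrightarrow>
    (AE t in lborel. even_log c v t = even_log c w t) \<and> (AE t in lborel. odd_log c v t = odd_log c w t)"
proof -
  have eq: "even_log c v t = even_log c w t \<and> odd_log c v t = odd_log c w t \<longleftrightarrow>
      v (exp t) = w (exp t) \<and> v (- exp t) = w (- exp t)" (is "?L \<longleftrightarrow> ?R") for t
  proof
    assume L: ?L
    have "2 * Mop c v (exp t) = 2 * Mop c w (exp t)" "2 * Mop c v (- exp t) = 2 * Mop c w (- exp t)"
      using conjunct1[OF L] conjunct2[OF L] unfolding even_log_def odd_log_def by algebra+
    then show ?R by (simp add: Mop_exp_cancel)
  qed (simp add: even_log_def odd_log_def Mop_def)
  have "(AE x in lborel. v x = w x) \<longleftrightarrow> (AE x in lborel. x \<noteq> 0 \<longrightarrow> v x = w x)"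
    by (rule AE_nonzero[symmetric])
  also have "\<dots> \<longleftrightarrow> (AE t in lborel. even_log c v t = even_log c w t \<and> odd_log c v t = odd_log c w t)"
    unfolding eq by (rule AE_lborel_exp_split)
  finally show ?thesis by (simp add: AE_conj_iff)
qed

text \<open>The squared weight e^((c+1)t) splits into the density |x|^c and the Jacobian
  e^t.\<close>

lemma nsq_Mop_exp:
  assumes [measurable]: "w \<in> borel_measurable borel"
  shows "nsq (\<lambda>t. Mop c w (exp t)) = (\<integral>\<^sup>+x. ennreal ((cmod (w x))\<^sup>2 * \<bar>x\<bar> powr c) * indicator {0<..} x \<partial>lborel)"
proof -
  have "(cmod (Mop c w (exp t)))\<^sup>2 = (cmod (w (exp t)))\<^sup>2 * exp t powr c * exp t" for t
  proof -
    have "(exp t powr ((c + 1) / 2))\<^sup>2 = exp t powr c * exp t"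
      by (simp add: powr_def power2_eq_square flip: exp_add) (simp add: field_simps)
    then show ?thesis by (simp add: Mop_def norm_mult power_mult_distrib)
  qed
  then have "nsq (\<lambda>t. Mop c w (exp t)) = (\<integral>\<^sup>+t. ennreal ((cmod (w (exp t)))\<^sup>2 * \<bar>exp t\<bar> powr c) * ennreal (exp t) \<partial>lborel)"
    unfolding nsq_def by (simp add: ennreal_mult)
  also have "\<dots> = (\<integral>\<^sup>+x. ennreal ((cmod (w x))\<^sup>2 * \<bar>x\<bar> powr c) * indicator {0<..} x \<partial>lborel)"
    by (rule nn_integral_exp_substitution[of "\<lambda>x. ennreal ((cmod (w x))\<^sup>2 * \<bar>x\<bar> powr c)"]) measurable
  finally show ?thesis .
qed

lemma nsq_Mop_minus_exp:
  assumes [measurable]: "w \<in> borel_measurable borel"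
  shows "nsq (\<lambda>t. Mop c w (- exp t)) = (\<integral>\<^sup>+x. ennreal ((cmod (w x))\<^sup>2 * \<bar>x\<bar> powr c) * indicator {..<0} x \<partial>lborel)"
proof -
  have "nsq (\<lambda>t. Mop c w (- exp t)) = nsq (\<lambda>t. Mop c (\<lambda>x. w (- x)) (exp t))"
    by (simp add: Mop_def)
  also have "\<dots> = (\<integral>\<^sup>+x. ennreal ((cmod (w (- x)))\<^sup>2 * \<bar>x\<bar> powr c) * indicator {0<..} x \<partial>lborel)"
    by (rule nsq_Mop_exp) measurable
  also have "\<dots> = (\<integral>\<^sup>+x. ennreal ((cmod (w (0 + - 1 * x)))\<^sup>2 * \<bar>0 + - 1 * x\<bar> powr c) * indicator {..<0} (0 + - 1 * x) \<partial>lborel)"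
    by (intro nn_integral_cong) (auto simp: indicator_def)
  also have "\<dots> = (\<integral>\<^sup>+x. ennreal ((cmod (w x))\<^sup>2 * \<bar>x\<bar> powr c) * indicator {..<0} x \<partial>lborel)"
    by (subst nn_integral_real_affine[of "\<lambda>x. ennreal ((cmod (w x))\<^sup>2 * \<bar>x\<bar> powr c) * indicator {..<0} x" "-1" 0]) auto
  finally show ?thesis .
qed

lemma L2w_iff:
  "w \<in> L2w c \<longleftrightarrow> w \<in> borel_measurable borel \<and> (\<lambda>t. Mop c w (exp t)) \<in> L2R \<and> (\<lambda>t. Mop c w (- exp t)) \<in> L2R"
proof (cases "w \<in> borel_measurable borel")
  case [measurable]: True
  have [measurable]: "(\<lambda>t. Mop c w (exp t)) \<in> borel_measurable borel" "(\<lambda>t. Mop c w (- exp t)) \<in> borel_measurable borel"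
    unfolding Mop_def by measurable
  let ?f = "\<lambda>x. ennreal ((cmod (w x))\<^sup>2 * \<bar>x\<bar> powr c)"
  have "(\<integral>\<^sup>+x. ?f x \<partial>lborel) = (\<integral>\<^sup>+x. ?f x * indicator {0<..} x + ?f x * indicator {..<0} x \<partial>lborel)"
    using AE_lborel_singleton[of "0::real"] by (intro nn_integral_cong_AE, eventually_elim) (auto simp: indicator_def)
  also have "\<dots> = nsq (\<lambda>t. Mop c w (exp t)) + nsq (\<lambda>t. Mop c w (- exp t))"
    by (subst nn_integral_add) (auto simp: nsq_Mop_exp nsq_Mop_minus_exp)
  finally show ?thesis by (simp add: L2w_def integrable_iff_bounded L2R_iff)
qed (simp add: L2w_def)

lemma L2R_even_log: "w \<in> L2w c \<Longrightarrow> even_log c w \<in> L2R"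
  unfolding even_log_def[abs_def] by (intro L2R_add) (auto simp: L2w_iff)

lemma L2R_odd_log: "w \<in> L2w c \<Longrightarrow> odd_log c w \<in> L2R"
  unfolding odd_log_def[abs_def] by (intro L2R_diff) (auto simp: L2w_iff)

lemma L2w_exists_even_odd_log:
  assumes "S \<in> L2R" "D \<in> L2R"
  shows "\<exists>w \<in> L2w c. even_log c w = S \<and> odd_log c w = D"
proof -
  have [measurable]: "S \<in> borel_measurable borel" "D \<in> borel_measurable borel"
    using assms by (auto simp: L2R_iff)
  \<comment> \<open>Half the sum of \<open>S\<close> and \<open>D\<close> on the positive axis, half
    their difference on the negative one, with the weight of \<open>Mop\<close> divided out; an
    explicit formula makes the two equations hold pointwise.\<close>
  define w where "w x = complex_of_real (\<bar>x\<bar> powr (- ((c + 1) / 2))) *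
    (1 / 2 * (S (ln \<bar>x\<bar>) + complex_of_real (sgn x) * D (ln \<bar>x\<bar>)))" for x
  have [measurable]: "w \<in> borel_measurable borel" unfolding w_def by measurable
  have cancel: "complex_of_real (exp t powr ((c + 1) / 2)) * (complex_of_real (exp t powr (- ((c + 1) / 2))) * z) = z" for t z
  proof -
    have "exp t powr ((c + 1) / 2) * exp t powr (- ((c + 1) / 2)) = 1"
      by (simp flip: powr_add)
    then show ?thesis by (metis mult.assoc mult_1 of_real_1 of_real_mult)
  qed
  have p: "Mop c w (exp t) = 1 / 2 * (S t + D t)" and m: "Mop c w (- exp t) = 1 / 2 * (S t - D t)" for t
    by (simp_all add: Mop_def w_def cancel del: times_divide_eq_left mult_1)
  have "w \<in> L2w c"
    unfolding L2w_iff p m by (intro conjI L2R_cmult L2R_add L2R_diff assms) measurable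
  moreover have "even_log c w = S" "odd_log c w = D"
    by (auto simp: even_log_def odd_log_def p m fun_eq_iff field_simps)
  ultimately show ?thesis by blast
qed

section \<open>The integral equation as a decoupled pair of convolutions\<close>

locale moving_average =
  fixes f :: "'a::euclidean_space \<Rightarrow> real" and sg :: bool and \<beta> c :: real
  assumes f_measurable [measurable]: "f \<in> borel_measurable borel"
    and weight_finite: "(\<integral>\<^sup>+ s. ennreal (indicator {s. f s \<noteq> 0} s * \<bar>f s\<bar> powr (\<beta> + (c - 1) / 2)) \<partial>lborel) < \<infinity>"
begin

text \<open>What is left of u(f)/|f| after the weight |f|^((c+1)/2) is absorbed, extended by 0 off
  the support. It is also the density in \<open>m_plus\<close>, and \<open>weight_finite\<close>
  bounds its L1 norm.\<close>

definition \<kappa> :: "'a \<Rightarrow> complex" where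
  "\<kappa> s = indicator {s. f s \<noteq> 0} s *\<^sub>R complex_of_real (u_fun sg \<beta> (f s) * \<bar>f s\<bar> powr ((c - 1) / 2))"

lemma measurable_kappa [measurable]: "\<kappa> \<in> borel_measurable borel"
  unfolding \<kappa>_def u_fun_def by measurable

lemma cmod_kappa: "cmod (\<kappa> s) = indicator {s. f s \<noteq> 0} s * \<bar>f s\<bar> powr (\<beta> + (c - 1) / 2)"
  by (simp add: \<kappa>_def u_fun_def norm_mult abs_mult powr_add indicator_def abs_sgn_eq)

lemma integrable_kappa: "integrable lborel \<kappa>"
  using weight_finite by (simp add: integrable_iff_bounded cmod_kappa)

lemma integrable_kappa_sgn: "integrable lborel (\<lambda>s. \<kappa> s * complex_of_real (sgn (f s)))"
  by (rule Bochner_Integration.integrable_bound[OF integrable_kappa])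
     (auto simp: norm_mult abs_sgn_eq)

text \<open>The displacement ln |f s| is meaningful only on the support of f; elsewhere
  \<open>\<kappa>\<close> vanishes.\<close>

sublocale plus: conv_kernel lborel \<kappa> "\<lambda>s. ln \<bar>f s\<bar>"
  by unfold_locales (use integrable_kappa in auto)

sublocale minus: conv_kernel lborel "\<lambda>s. \<kappa> s * complex_of_real (sgn (f s))" "\<lambda>s. ln \<bar>f s\<bar>"
  by unfold_locales (use integrable_kappa_sgn in auto)

lemma m_plus_eq: "m_plus f sg \<beta> c = plus.multiplier"
  by (simp add: m_plus_def plus.multiplier_def set_lebesgue_integral_def \<kappa>_def fun_eq_iff)

lemma m_minus_eq: "m_minus f sg \<beta> c = minus.multiplier"
  by (rule ext) (simp add: m_minus_def minus.multiplier_def set_lebesgue_integral_def, simp add: \<kappa>_def mult_ac)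

text \<open>Here \<open>e\<close> selects the half-line of x. The argument of w lies on the
  half-line with sign e sgn(f s), at logarithmic coordinate t - ln |f s|, and that component is half
  of \<open>even_log\<close> plus e sgn(f s) times \<open>odd_log\<close>.\<close>

lemma kernel_log_coordinates:
  assumes e: "e = 1 \<or> e = - 1"
  shows "indicator {s. f s \<noteq> 0} s *\<^sub>R (complex_of_real (u_fun sg \<beta> (f s) / \<bar>f s\<bar>) * w (e * exp t / f s))
    = complex_of_real (exp t powr (- ((c + 1) / 2)) / 2) *
      (\<kappa> s * even_log c w (t - ln \<bar>f s\<bar>)
        + complex_of_real e * (\<kappa> s * complex_of_real (sgn (f s)) * odd_log c w (t - ln \<bar>f s\<bar>)))"
proof (cases "f s = 0")
  case True
  then show ?thesis by (simp add: \<kappa>_def)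
next
  case False
  define a where "a = (c + 1) / 2"
  define W where "W e = Mop c w (e * exp (t - ln \<bar>f s\<bar>))" for e
  have sg: "sgn (f s) = 1 \<or> sgn (f s) = - 1" using False by (auto simp: sgn_if)
  have fs: "f s = sgn (f s) * \<bar>f s\<bar>" by (simp add: sgn_mult_abs)
  have exp_eq: "exp (t - ln \<bar>f s\<bar>) = exp t / \<bar>f s\<bar>" using False by (simp add: exp_diff)
  \<comment> \<open>The sign of f s is its own inverse, so dividing by it and multiplying by it
    agree.\<close>
  have x: "e * exp t / f s = (e * sgn (f s)) * exp (t - ln \<bar>f s\<bar>)"
    using sg False unfolding exp_eq by (subst fs) (auto simp: field_simps)
  have "complex_of_real (\<bar>f s\<bar> powr a) * complex_of_real (exp t powr (- a)) * W (e * sgn (f s)) = w (e * exp t / f s)"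
  proof -
    have ax: "\<bar>e * exp t / f s\<bar> = exp t / \<bar>f s\<bar>" using e by (auto simp: abs_mult abs_divide)
    have "\<bar>f s\<bar> powr a * exp t powr (- a) * (exp t / \<bar>f s\<bar>) powr a = 1"
      using False by (simp add: powr_divide powr_minus field_simps)
    then have "complex_of_real (\<bar>f s\<bar> powr a) * complex_of_real (exp t powr (- a)) * complex_of_real ((exp t / \<bar>f s\<bar>) powr a) = 1"
      by (metis of_real_1 of_real_mult)
    then show ?thesis
      unfolding W_def x[symmetric] Mop_def ax a_def[symmetric] by (simp flip: mult.assoc)
  qed
  then have w_eq: "w (e * exp t / f s) = complex_of_real (\<bar>f s\<bar> powr a) * complex_of_real (exp t powr (- a)) * W (e * sgn (f s))" ..
  have W_eq: "W (e * sgn (f s)) = 1 / 2 * (even_log c w (t - ln \<bar>f s\<bar>) + complex_of_real e * complex_of_real (sgn (f s)) * odd_log c w (t - ln \<bar>f s\<bar>))"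
    using e sg by (auto simp: even_log_def odd_log_def W_def)
  have "\<bar>f s\<bar> powr a / \<bar>f s\<bar> = \<bar>f s\<bar> powr (a - 1)" using False by (simp add: powr_diff)
  also have "a - 1 = (c - 1) / 2" by (simp add: a_def field_simps)
  finally have "u_fun sg \<beta> (f s) / \<bar>f s\<bar> * \<bar>f s\<bar> powr a = u_fun sg \<beta> (f s) * \<bar>f s\<bar> powr ((c - 1) / 2)"
    unfolding times_divide_eq_left times_divide_eq_right[symmetric] by (rule arg_cong)
  then have k: "complex_of_real (u_fun sg \<beta> (f s) / \<bar>f s\<bar>) * complex_of_real (\<bar>f s\<bar> powr a) = \<kappa> s"
    using False unfolding of_real_mult[symmetric] by (simp add: \<kappa>_def)
  have "complex_of_real (u_fun sg \<beta> (f s) / \<bar>f s\<bar>) * w (e * exp t / f s)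
    = \<kappa> s * complex_of_real (exp t powr (- a)) * W (e * sgn (f s))"
    unfolding w_eq k[symmetric] by (simp only: mult.assoc)
  then show ?thesis
    using False unfolding W_eq a_def by (simp add: algebra_simps)
qed

text \<open>For w in L2w both convolution integrals converge for almost every t, which settles the
  integrability clause of \<open>solves_E\<close>. The equations at e^t and -e^t are then the sum
  and the difference of the two convolution equations.\<close>

lemma solves_E_iff:
  assumes w: "w \<in> L2w c"
  shows "solves_E f sg \<beta> v w \<longleftrightarrow>
    (AE t in lborel. plus.conv (even_log c w) t = even_log c v t) \<and>
    (AE t in lborel. minus.conv (odd_log c w) t = odd_log c v t)"
proof -
  define E where "E x \<longleftrightarrow> set_integrable lborel {s. f s \<noteq> 0}
        (\<lambda>s. complex_of_real (u_fun sg \<beta> (f s) / \<bar>f s\<bar>) * w (x / f s)) \<and>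
      v x = (LINT s:{s. f s \<noteq> 0}|lborel. complex_of_real (u_fun sg \<beta> (f s) / \<bar>f s\<bar>) * w (x / f s))" for x
  have "solves_E f sg \<beta> v w \<longleftrightarrow> (AE t in lborel. E (exp t) \<and> E (- exp t))"
    unfolding solves_E_def E_def by (rule AE_lborel_exp_split)
  also have "\<dots> \<longleftrightarrow> (AE t in lborel. plus.conv (even_log c w) t = even_log c v t \<and>
      minus.conv (odd_log c w) t = odd_log c v t)"
  \<comment> \<open>The equivalence is proved for each t at which both convolution integrals
    converge, as linearity of the integral is used there.\<close>
  proof (rule eventually_subst)
    show "AE t in lborel. (E (exp t) \<and> E (- exp t)) = (plus.conv (even_log c w) t = even_log c v t \<and>
      minus.conv (odd_log c w) t = odd_log c v t)"
      using plus.AE_integrable_conv[OF L2R_even_log[OF w]] minus.AE_integrable_conv[OF L2R_odd_log[OF w]]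
    proof eventually_elim
      case (elim t)
      define p where "p = plus.conv (even_log c w) t"
      define m where "m = minus.conv (odd_log c w) t"
      have E: "E (e * exp t) \<longleftrightarrow> even_log c v t + complex_of_real e * odd_log c v t = p + complex_of_real e * m"
        if e: "e = 1 \<or> e = - 1" for e
      proof -
        let ?r = "complex_of_real (exp t powr (- ((c + 1) / 2)) / 2)"
        have r: "?r \<noteq> 0" by simp
        have I: "integrable lborel (\<lambda>s. \<kappa> s * even_log c w (t - ln \<bar>f s\<bar>)
            + complex_of_real e * (\<kappa> s * complex_of_real (sgn (f s)) * odd_log c w (t - ln \<bar>f s\<bar>)))"
          using elim by (intro Bochner_Integration.integrable_add integrable_mult_right)
        have "set_integrable lborel {s. f s \<noteq> 0} (\<lambda>s. complex_of_real (u_fun sg \<beta> (f s) / \<bar>f s\<bar>) * w (e * exp t / f s))"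
          unfolding set_integrable_def kernel_log_coordinates[OF e] by (intro integrable_mult_right I)
        moreover have "(LINT s:{s. f s \<noteq> 0}|lborel. complex_of_real (u_fun sg \<beta> (f s) / \<bar>f s\<bar>) * w (e * exp t / f s))
            = ?r * (p + complex_of_real e * m)"
        proof -
          have "(LINT s:{s. f s \<noteq> 0}|lborel. complex_of_real (u_fun sg \<beta> (f s) / \<bar>f s\<bar>) * w (e * exp t / f s))
            = ?r * (LINT s|lborel. \<kappa> s * even_log c w (t - ln \<bar>f s\<bar>)
            + complex_of_real e * (\<kappa> s * complex_of_real (sgn (f s)) * odd_log c w (t - ln \<bar>f s\<bar>)))"
            unfolding set_lebesgue_integral_def kernel_log_coordinates[OF e] by (rule integral_mult_right_zero)
          also have "(LINT s|lborel. \<kappa> s * even_log c w (t - ln \<bar>f s\<bar>)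
            + complex_of_real e * (\<kappa> s * complex_of_real (sgn (f s)) * odd_log c w (t - ln \<bar>f s\<bar>)))
            = p + (LINT s|lborel. complex_of_real e * (\<kappa> s * complex_of_real (sgn (f s)) * odd_log c w (t - ln \<bar>f s\<bar>)))"
            unfolding p_def plus.conv_def using elim by (intro Bochner_Integration.integral_add integrable_mult_right)
          also have "(LINT s|lborel. complex_of_real e * (\<kappa> s * complex_of_real (sgn (f s)) * odd_log c w (t - ln \<bar>f s\<bar>)))
            = complex_of_real e * m"
            unfolding m_def minus.conv_def by (rule integral_mult_right_zero)
          finally show ?thesis .
        qed
        moreover have "v (e * exp t) = ?r * (even_log c v t + complex_of_real e * odd_log c v t)"
        proof -
          have "complex_of_real (exp t powr (- ((c + 1) / 2))) * complex_of_real (exp t powr ((c + 1) / 2)) = 1"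
            by (simp flip: of_real_mult powr_add)
          then have "complex_of_real (exp t powr (- ((c + 1) / 2))) * Mop c v (e * exp t) = v (e * exp t)"
            using e by (auto simp: Mop_def abs_mult simp flip: mult.assoc)
          moreover have "even_log c v t + complex_of_real e * odd_log c v t = 2 * Mop c v (e * exp t)"
            using e by (auto simp: even_log_def odd_log_def)
          ultimately show ?thesis by simp
        qed
        ultimately have "E (e * exp t) \<longleftrightarrow> ?r * (even_log c v t + complex_of_real e * odd_log c v t) = ?r * (p + complex_of_real e * m)"
          unfolding E_def by (simp only: simp_thms)
        then show ?thesis by (simp only: mult_left_cancel[OF r])
      qed
      have "E (exp t) \<longleftrightarrow> even_log c v t + odd_log c v t = p + m" using E[of 1] by simp
      moreover have "E (- exp t) \<longleftrightarrow> even_log c v t - odd_log c v t = p - m" using E[of "-1"] by simp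
      moreover have "x + y = p + m \<and> x - y = p - m \<longleftrightarrow> p = x \<and> m = y" for x y
      proof
        assume *: "x + y = p + m \<and> x - y = p - m"
        have "2 * p = 2 * x" "2 * m = 2 * y" using conjunct1[OF *] conjunct2[OF *] by algebra+
        then show "p = x \<and> m = y" by simp
      qed auto
      ultimately show ?case unfolding p_def m_def by simp
    qed
  qed
  finally show ?thesis by (simp only: AE_conj_iff)
qed

lemma unique_solution_iff:
  "(\<forall>v w1 w2. v \<in> L2w c \<longrightarrow> w1 \<in> L2w c \<longrightarrow> w2 \<in> L2w c \<longrightarrow>
      solves_E f sg \<beta> v w1 \<longrightarrow> solves_E f sg \<beta> v w2 \<longrightarrow> (AE x in lborel. w1 x = w2 x))
    \<longleftrightarrow> (AE x in lborel. m_plus f sg \<beta> c x \<noteq> 0) \<and> (AE x in lborel. m_minus f sg \<beta> c x \<noteq> 0)"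
  (is "?U \<longleftrightarrow> _")
  unfolding m_plus_eq m_minus_eq plus.conv_injective_iff[symmetric] minus.conv_injective_iff[symmetric]
proof
  assume U: ?U
  \<comment> \<open>Proved for a pair; inserting 0 for one member yields each injectivity statement
    alone. The function \<open>z\<close> with zero components serves both as right-hand side and as
    competing solution.\<close>
  have zero: "AE t in lborel. S t = 0" "AE t in lborel. D t = 0"
    if SD: "S \<in> L2R" "D \<in> L2R" "AE t in lborel. plus.conv S t = 0" "AE t in lborel. minus.conv D t = 0" for S D
  proof -
    obtain w where w: "w \<in> L2w c" "even_log c w = S" "odd_log c w = D"
      using L2w_exists_even_odd_log[OF SD(1,2)] by blast
    obtain z where z: "z \<in> L2w c" "even_log c z = (\<lambda>t. 0)" "odd_log c z = (\<lambda>t. 0)"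
      using L2w_exists_even_odd_log[OF L2R_zero L2R_zero] by blast
    have "solves_E f sg \<beta> z w" using SD w z by (simp add: solves_E_iff)
    moreover have "solves_E f sg \<beta> z z" using z by (simp add: solves_E_iff plus.conv_def minus.conv_def)
    ultimately have "AE x in lborel. w x = z x" using U w z by blast
    then show "AE t in lborel. S t = 0" "AE t in lborel. D t = 0"
      unfolding AE_eq_iff_even_odd_log[of w z c] w z by auto
  qed
  have "AE t in lborel. plus.conv (\<lambda>t. 0) t = 0" "AE t in lborel. minus.conv (\<lambda>t. 0) t = 0"
    by (auto simp: plus.conv_def minus.conv_def)
  then show "(\<forall>\<phi>\<in>L2R. (AE t in lborel. plus.conv \<phi> t = 0) \<longrightarrow> (AE t in lborel. \<phi> t = 0)) \<and>
    (\<forall>\<phi>\<in>L2R. (AE t in lborel. minus.conv \<phi> t = 0) \<longrightarrow> (AE t in lborel. \<phi> t = 0))"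
    using zero(1)[OF _ L2R_zero] zero(2)[OF L2R_zero] by blast
next
  assume inj: "(\<forall>\<phi>\<in>L2R. (AE t in lborel. plus.conv \<phi> t = 0) \<longrightarrow> (AE t in lborel. \<phi> t = 0)) \<and>
    (\<forall>\<phi>\<in>L2R. (AE t in lborel. minus.conv \<phi> t = 0) \<longrightarrow> (AE t in lborel. \<phi> t = 0))"
  show ?U
  proof (intro allI impI)
    fix v w1 w2
    assume w: "w1 \<in> L2w c" "w2 \<in> L2w c" and E: "solves_E f sg \<beta> v w1" "solves_E f sg \<beta> v w2"
    have "AE t in lborel. plus.conv (\<lambda>t. even_log c w1 t - even_log c w2 t) t = 0"
      using plus.conv_diff_AE[OF L2R_even_log[OF w(1)] L2R_even_log[OF w(2)]]
        conjunct1[OF E(1)[unfolded solves_E_iff[OF w(1)]]] conjunct1[OF E(2)[unfolded solves_E_iff[OF w(2)]]]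
      by eventually_elim simp
    then have "AE t in lborel. even_log c w1 t - even_log c w2 t = 0"
      using inj L2R_diff[OF L2R_even_log[OF w(1)] L2R_even_log[OF w(2)]] by blast
    moreover have "AE t in lborel. minus.conv (\<lambda>t. odd_log c w1 t - odd_log c w2 t) t = 0"
      using minus.conv_diff_AE[OF L2R_odd_log[OF w(1)] L2R_odd_log[OF w(2)]]
        conjunct2[OF E(1)[unfolded solves_E_iff[OF w(1)]]] conjunct2[OF E(2)[unfolded solves_E_iff[OF w(2)]]]
      by eventually_elim simp
    then have "AE t in lborel. odd_log c w1 t - odd_log c w2 t = 0"
      using inj L2R_diff[OF L2R_odd_log[OF w(1)] L2R_odd_log[OF w(2)]] by blast
    ultimately show "AE x in lborel. w1 x = w2 x"
      unfolding AE_eq_iff_even_odd_log[of w1 w2 c] by simp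
  qed
qed

lemma solution_exists:
  assumes "\<exists>\<phi> \<in> L2R. AE t in lborel. plus.conv \<phi> t = even_log c v t"
    and "\<exists>\<phi> \<in> L2R. AE t in lborel. minus.conv \<phi> t = odd_log c v t"
  shows "\<exists>w \<in> L2w c. solves_E f sg \<beta> v w"
proof -
  obtain S D where SD: "S \<in> L2R" "D \<in> L2R" "AE t in lborel. plus.conv S t = even_log c v t"
    "AE t in lborel. minus.conv D t = odd_log c v t"
    using assms by blast
  obtain w where "w \<in> L2w c" "even_log c w = S" "odd_log c w = D"
    using L2w_exists_even_odd_log[OF SD(1,2)] by blast
  then show ?thesis using SD by (auto simp: solves_E_iff)
qed

lemma always_solvable_iff:
  "(\<forall>v \<in> L2w c. \<exists>w \<in> L2w c. solves_E f sg \<beta> v w)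
    \<longleftrightarrow> (INF x. cmod (m_plus f sg \<beta> c x)) > 0 \<and> (INF x. cmod (m_minus f sg \<beta> c x)) > 0"
  unfolding m_plus_eq m_minus_eq plus.conv_surjective_iff[symmetric] minus.conv_surjective_iff[symmetric]
proof
  assume solv: "\<forall>v \<in> L2w c. \<exists>w \<in> L2w c. solves_E f sg \<beta> v w"
  have "(\<exists>\<phi>\<in>L2R. AE t in lborel. plus.conv \<phi> t = \<psi> t) \<and> (\<exists>\<phi>\<in>L2R. AE t in lborel. minus.conv \<phi> t = \<psi> t)"
    if \<psi>: "\<psi> \<in> L2R" for \<psi>
  proof -
    \<comment> \<open>Using \<psi> for both components lets one solution w answer both surjectivity
      questions.\<close>
    obtain v where v: "v \<in> L2w c" "even_log c v = \<psi>" "odd_log c v = \<psi>"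
      using L2w_exists_even_odd_log[OF \<psi> \<psi>] by blast
    obtain w where w: "w \<in> L2w c" "solves_E f sg \<beta> v w" using solv v by blast
    then show ?thesis
      using L2R_even_log[OF w(1)] L2R_odd_log[OF w(1)] unfolding solves_E_iff[OF w(1)] v by blast
  qed
  then show "(\<forall>\<psi>\<in>L2R. \<exists>\<phi>\<in>L2R. AE t in lborel. plus.conv \<phi> t = \<psi> t) \<and>
    (\<forall>\<psi>\<in>L2R. \<exists>\<phi>\<in>L2R. AE t in lborel. minus.conv \<phi> t = \<psi> t)" by blast
next
  assume surj: "(\<forall>\<psi>\<in>L2R. \<exists>\<phi>\<in>L2R. AE t in lborel. plus.conv \<phi> t = \<psi> t) \<and>
    (\<forall>\<psi>\<in>L2R. \<exists>\<phi>\<in>L2R. AE t in lborel. minus.conv \<phi> t = \<psi> t)"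
  show "\<forall>v \<in> L2w c. \<exists>w \<in> L2w c. solves_E f sg \<beta> v w"
  proof
    fix v assume v: "v \<in> L2w c"
    show "\<exists>w \<in> L2w c. solves_E f sg \<beta> v w"
      using surj L2R_even_log[OF v] L2R_odd_log[OF v] by (intro solution_exists) auto
  qed
qed

text \<open>Existence comes from the two Sobolev solvability results; uniqueness from part (a),
  since the lower bounds keep both multipliers away from 0 at every point.\<close>

lemma unique_sobolev_solution:
  assumes \<alpha>: "\<alpha> \<ge> 0" and \<gamma>: "\<gamma> > 0"
    and mp: "\<And>x. cmod (m_plus f sg \<beta> c x) \<ge> \<gamma> / (1 + rpow \<bar>x\<bar> \<alpha>)"
    and mm: "\<And>x. cmod (m_minus f sg \<beta> c x) \<ge> \<gamma> / (1 + rpow \<bar>x\<bar> \<alpha>)"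
    and v: "v \<in> L2w c" "(\<lambda>x. Mop c v (exp x)) \<in> sobolev_H \<alpha>" "(\<lambda>x. Mop c v (- exp x)) \<in> sobolev_H \<alpha>"
  shows "\<exists>w \<in> L2w c. solves_E f sg \<beta> v w \<and>
    (\<forall>w' \<in> L2w c. solves_E f sg \<beta> v w' \<longrightarrow> (AE x in lborel. w' x = w x))"
proof -
  have "even_log c v \<in> sobolev_H \<alpha>" "odd_log c v \<in> sobolev_H \<alpha>"
    unfolding even_log_def[abs_def] odd_log_def[abs_def] by (intro sobolev_H_add sobolev_H_diff v)+
  then obtain w where w: "w \<in> L2w c" "solves_E f sg \<beta> v w"
    using solution_exists[OF plus.conv_solvable_sobolev[OF \<alpha> \<gamma> mp[unfolded m_plus_eq]]
        minus.conv_solvable_sobolev[OF \<alpha> \<gamma> mm[unfolded m_minus_eq]]] by blast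
  have pos: "\<gamma> / (1 + rpow \<bar>x\<bar> \<alpha>) > 0" for x :: real
  proof -
    have "rpow \<bar>x\<bar> \<alpha> \<ge> 0" by (simp add: rpow_def)
    then show ?thesis using \<gamma> by (intro divide_pos_pos) auto
  qed
  have "m_plus f sg \<beta> c x \<noteq> 0" "m_minus f sg \<beta> c x \<noteq> 0" for x
    using mp[of x] mm[of x] pos[of x] by auto
  then show ?thesis using unique_solution_iff w v(1) by (intro bexI[of _ w]) auto
qed

end

theorem mainTheorem1:
  fixes f :: "'a::euclidean_space \<Rightarrow> real" and c \<beta> :: real and sg :: bool
  assumes f_meas: "f \<in> borel_measurable borel"
    and c_nonneg: "c \<ge> 0"
    and integr: "(\<integral>\<^sup>+ s. ennreal (indicator {s. f s \<noteq> 0} s * \<bar>f s\<bar> powr (\<beta> + (c - 1) / 2)) \<partial>lborel) < \<infinity>"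
  shows
    "((\<forall>v w1 w2. v \<in> L2w c \<longrightarrow> w1 \<in> L2w c \<longrightarrow> w2 \<in> L2w c \<longrightarrow>
         solves_E f sg \<beta> v w1 \<longrightarrow> solves_E f sg \<beta> v w2 \<longrightarrow> (AE x in lborel. w1 x = w2 x))
      \<longleftrightarrow> ((AE x in lborel. m_plus f sg \<beta> c x \<noteq> 0) \<and> (AE x in lborel. m_minus f sg \<beta> c x \<noteq> 0)))
   \<and> ((\<forall>v \<in> L2w c. \<exists>w \<in> L2w c. solves_E f sg \<beta> v w)
      \<longleftrightarrow> ((INF x. cmod (m_plus f sg \<beta> c x)) > 0 \<and> (INF x. cmod (m_minus f sg \<beta> c x)) > 0))
   \<and> (\<forall>\<alpha> \<gamma> v. \<alpha> \<ge> 0 \<longrightarrow> \<gamma> > 0 \<longrightarrow>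
        (\<forall>x. cmod (m_plus f sg \<beta> c x) \<ge> \<gamma> / (1 + rpow \<bar>x\<bar> \<alpha>)) \<longrightarrow>
        (\<forall>x. cmod (m_minus f sg \<beta> c x) \<ge> \<gamma> / (1 + rpow \<bar>x\<bar> \<alpha>)) \<longrightarrow>
        v \<in> L2w c \<longrightarrow>
        (\<lambda>x. Mop c v (exp x)) \<in> sobolev_H \<alpha> \<longrightarrow>
        (\<lambda>x. Mop c v (- exp x)) \<in> sobolev_H \<alpha> \<longrightarrow>
        (\<exists>w \<in> L2w c. solves_E f sg \<beta> v w \<and>
           (\<forall>w' \<in> L2w c. solves_E f sg \<beta> v w' \<longrightarrow> (AE x in lborel. w' x = w x))))"
proof -
  interpret moving_average f sg \<beta> c by unfold_locales (fact f_meas, fact integr)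
  show ?thesis
  proof (intro conjI allI impI)
    fix \<alpha> \<gamma> v
    assume "\<alpha> \<ge> 0" "\<gamma> > 0"
      and "\<forall>x. cmod (m_plus f sg \<beta> c x) \<ge> \<gamma> / (1 + rpow \<bar>x\<bar> \<alpha>)"
      and "\<forall>x. cmod (m_minus f sg \<beta> c x) \<ge> \<gamma> / (1 + rpow \<bar>x\<bar> \<alpha>)"
      and "v \<in> L2w c" "(\<lambda>x. Mop c v (exp x)) \<in> sobolev_H \<alpha>" "(\<lambda>x. Mop c v (- exp x)) \<in> sobolev_H \<alpha>"
    then show "\<exists>w \<in> L2w c. solves_E f sg \<beta> v w \<and>
        (\<forall>w' \<in> L2w c. solves_E f sg \<beta> v w' \<longrightarrow> (AE x in lborel. w' x = w x))"
      by (intro unique_sobolev_solution[of \<alpha> \<gamma>]) auto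
  qed (rule unique_solution_iff always_solvable_iff)+
qed

end
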